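(* Let $(M,g_0)$ be a totally geodesic lightlike hypersurface of an $(n+2)$-dimensional Lorentzian manifold, with conformal structure $c=[g_0]_0$ and integrable screen distribution $S(TM)$, and let $D$ be a Weyl screen structure on $(M,c,S(TM))$. Let $\Omega^1_{hor}(M)$ be the space of horizontal 1-forms on $M$, i.e. $\omega\in\Omega^1_{hor}(M)$ if and only if $\omega(X)=0$ for all $X\in\mathrm{Rad}\,TM$. (i) For any $g\in c$, $\theta_g\in\Omega^1_{hor}(M)$. (ii) For $g\in c$ there exist a unique $\theta_g\in\Omega^1_{hor}(M)$ and a unique $S\in S^2T^*M$ such that for $X,Y\in\Gamma(TM)$, $$D_XY=D^g_XY+\theta_g(X)Y+\theta_g(Y)X-g(X,Y)\theta_g^{\sharp_g}-S(X,Y)\xi,$$ where $\theta_g^{\sharp_g}$ is the dual of $\theta_g$ with respect to the degenerate metric $g$ and the screen distribution $S(TM)$. Furthermore, $$S(X,Y)=\begin{cases}0&\text{if }X,Y\in\mathrm{Rad}\,TM,\\ C(X,Y)+\eta(X)\theta_g(Y)&\text{if }(X,Y)\in\Gamma(TM)\times\Gamma(S(TM)),\end{cases}$$ where $C$ denotes the second fundamental form of $S(TM)$ in $(M,g)$.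
   Context: $M$ is a hypersurface of $(\bar M,\bar g)$ whose induced metric $g_0$ has constant rank $n$; $TM^\perp=\mathrm{Rad}\,TM=\ker g_0$ has nowhere vanishing (local) section $\xi$. A screen distribution $S(TM)$ is a complement of $TM^\perp$ in $TM$; $P:TM\to S(TM)$ is the projection along $TM^\perp$. $\eta$ is the 1-form with $\eta(\xi)=1$, $\ker\eta=S(TM)$ (i.e. $\eta=\bar g(N,\cdot)$ for the null transversal field $N$ with $\bar g(N,\xi)=1$, $N\perp S(TM)$). Totally geodesic: $\bar g(\bar\nabla_XY,\xi)=0$ for all $X,Y$ tangent to $M$. $c=[g_0]_0$ is the set of metrics $g=e^{-2f}g_0$ with $X(f)=0$ for $X\in TM^\perp$. A Weyl structure on $(M,c)$ is a torsion-free connection $D$ such that for each $g\in c$ there is a unique 1-form $\theta_g$ with $Dg=-2\theta_g\otimes g$; it is a Weyl screen structure relative to $(M,c,S(TM))$ if $D_XPY\in\Gamma(S(TM))$ for all $X,Y\in\Gamma(TM)$. The section $\xi$ is normalised so that $D_\xi\xi=0$, and for $g\in c$, $D^g$ is a torsion-free connection with $D^gg=0$ and $D^g_\xi\xi=0$. The second fundamental form $C$ of $S(TM)$ in $(M,g)$ is defined by $D^g_XPY=\overset{\star}{\nabla}_XPY+C(X,PY)\xi$ with $\overset{\star}{\nabla}_XPY\in\Gamma(S(TM))$. For a 1-form $\omega$, $\omega^{\sharp_g}$ is the vector field with $\omega=g(\omega^{\sharp_g},\cdot)+\eta(\omega^{\sharp_g})\eta$. $S^2T^*M$ denotes (sections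 of) the bundle of symmetric $(0,2)$-tensors. *)

theory Defs
  imports "HOL-Analysis.Analysis" "HOL-Library.Function_Algebras"
begin

text \<open>
  Conventions. A smooth manifold is a Hausdorff, second countable type of points together with a
  smooth atlas. Tangent vectors at a point \<open>p\<close> are derivations on the germs of smooth functions
  at \<open>p\<close>; as HOL functions they take the value \<open>0\<close> at every argument that is not smooth near \<open>p\<close>.
  Vector fields, forms and connections are used locally: a vector field on an open set
  \<open>V\<close> is a total function of which only the values on \<open>V\<close> matter, and ``for all \<open>X \<in> \<Gamma>(TM)\<close>''
  is read as ``for all open \<open>V\<close> and all smooth vector fields \<open>X\<close> on \<open>V\<close>''.
  In contrast, tensors are extensional (\<open>0\<close> off their domain), so that two of them are equal as HOL
  functions iff they are equal as tensors.
\<close>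


subsection \<open>Smooth functions and manifolds\<close>

primrec Ck_on :: "nat \<Rightarrow> ('e::euclidean_space \<Rightarrow> 'f::real_normed_vector) \<Rightarrow> 'e set \<Rightarrow> bool" where
  "Ck_on 0 f S \<longleftrightarrow> continuous_on S f"
| "Ck_on (Suc k) f S \<longleftrightarrow> (\<forall>x\<in>S. f differentiable (at x)) \<and>
     (\<forall>w. Ck_on k (\<lambda>x. frechet_derivative f (at x) w) S)"

text \<open>Only used for open \<open>S\<close>.\<close>
definition Cinf_on :: "('e::euclidean_space \<Rightarrow> 'f::real_normed_vector) \<Rightarrow> 'e set \<Rightarrow> bool" where
  "Cinf_on f S \<longleftrightarrow> (\<forall>k. Ck_on k f S)"

type_synonym ('p, 'e) atlas = "('p set \<times> ('p \<Rightarrow> 'e)) set"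

definition smooth_atlas ::
  "('p::{t2_space, second_countable_topology}, 'e::euclidean_space) atlas \<Rightarrow> bool" where
  "smooth_atlas A \<longleftrightarrow>
     (\<Union>(W, \<phi>)\<in>A. W) = UNIV \<and>
     (\<forall>(W, \<phi>)\<in>A. open W \<and> open (\<phi> ` W) \<and> homeomorphism W (\<phi> ` W) \<phi> (inv_into W \<phi>)) \<and>
     (\<forall>(W, \<phi>)\<in>A. \<forall>(W', \<phi>')\<in>A. Cinf_on (\<phi>' \<circ> inv_into W \<phi>) (\<phi> ` (W \<inter> W')))"

definition smooth_fun ::
  "('p::topological_space, 'e::euclidean_space) atlas \<Rightarrow> 'p set \<Rightarrow> ('p \<Rightarrow> real) \<Rightarrow> bool" where
  "smooth_fun A V h \<longleftrightarrow> (\<forall>(W, \<phi>)\<in>A. Cinf_on (h \<circ> inv_into W \<phi>) (\<phi> ` (V \<inter> W)))"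

definition smooth_near ::
  "('p::topological_space, 'e::euclidean_space) atlas \<Rightarrow> 'p \<Rightarrow> ('p \<Rightarrow> real) \<Rightarrow> bool" where
  "smooth_near A p h \<longleftrightarrow> (\<exists>V. open V \<and> p \<in> V \<and> smooth_fun A V h)"


subsection \<open>Linear algebra in spaces of functionals\<close>

text \<open>
  Tangent spaces and cotangent spaces are linear subspaces of function spaces \<open>'a \<Rightarrow> real\<close>;
  addition is the pointwise one of \<open>Function_Algebras\<close>, scalar multiplication is the following.
\<close>
definition fscale :: "real \<Rightarrow> ('a \<Rightarrow> real) \<Rightarrow> 'a \<Rightarrow> real" where
  "fscale a f = (\<lambda>x. a * f x)"

interpretation fvs: vector_space fscale
  by unfold_locales (auto simp: fscale_def fun_eq_iff algebra_simps)

text \<open>The rank of a bilinear form \<open>b\<close> on \<open>T\<close> is that of the induced map \<open>T \<rightarrow> T\<^sup>*\<close>.\<close>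
definition form_rank ::
  "('a \<Rightarrow> real) set \<Rightarrow> (('a \<Rightarrow> real) \<Rightarrow> ('a \<Rightarrow> real) \<Rightarrow> real) \<Rightarrow> nat" where
  "form_rank T b = fvs.dim ((\<lambda>v w. if w \<in> T then b v w else 0) ` T)"


subsection \<open>Tangent vectors, vector fields, tensors\<close>

type_synonym 'p tvec = "('p \<Rightarrow> real) \<Rightarrow> real"
type_synonym 'p vfield = "'p \<Rightarrow> 'p tvec"
type_synonym 'p form1 = "'p \<Rightarrow> 'p tvec \<Rightarrow> real"
type_synonym 'p form2 = "'p \<Rightarrow> 'p tvec \<Rightarrow> 'p tvec \<Rightarrow> real"

text \<open>Directional derivative at \<open>p\<close> in the coordinate direction \<open>w\<close> of the chart \<open>(W, \<phi>)\<close>.\<close>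
definition chart_vec :: "('p::topological_space, 'e::euclidean_space) atlas \<Rightarrow>
    'p set \<times> ('p \<Rightarrow> 'e) \<Rightarrow> 'p \<Rightarrow> 'e \<Rightarrow> 'p tvec" where
  "chart_vec A = (\<lambda>(W, \<phi>) p w h.
     if smooth_near A p h then frechet_derivative (h \<circ> inv_into W \<phi>) (at (\<phi> p)) w else 0)"

definition tspace :: "('p::topological_space, 'e::euclidean_space) atlas \<Rightarrow> 'p \<Rightarrow> 'p tvec set" where
  "tspace A p = {v. \<exists>c\<in>A. p \<in> fst c \<and> v \<in> range (chart_vec A c p)}"

definition vfields :: "('p::topological_space, 'e::euclidean_space) atlas \<Rightarrow> 'p set \<Rightarrow> 'p vfield set"
  where "vfields A V = {X. (\<forall>p\<in>V. X p \<in> tspace A p) \<and>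
     (\<forall>W h. open W \<and> W \<subseteq> V \<and> smooth_fun A W h \<longrightarrow> smooth_fun A W (\<lambda>p. X p h))}"

definition lie_bracket ::
  "('p::topological_space, 'e::euclidean_space) atlas \<Rightarrow> 'p vfield \<Rightarrow> 'p vfield \<Rightarrow> 'p vfield" where
  "lie_bracket A X Y = (\<lambda>p h.
     if smooth_near A p h then X p (\<lambda>q. Y q h) - Y p (\<lambda>q. X q h) else 0)"

definition linear_on :: "('a \<Rightarrow> real) set \<Rightarrow> (('a \<Rightarrow> real) \<Rightarrow> real) \<Rightarrow> bool" where
  "linear_on T l \<longleftrightarrow>
     (\<forall>v\<in>T. \<forall>w\<in>T. l (v + w) = l v + l w) \<and> (\<forall>a. \<forall>v\<in>T. l (fscale a v) = a * l v)"

definition forms1 :: "('p::topological_space, 'e::euclidean_space) atlas \<Rightarrow> 'p set \<Rightarrow> 'p form1 set"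
  where "forms1 A U = {\<omega>.
     (\<forall>p\<in>U. linear_on (tspace A p) (\<omega> p)) \<and>
     (\<forall>p v. \<not> (p \<in> U \<and> v \<in> tspace A p) \<longrightarrow> \<omega> p v = 0) \<and>
     (\<forall>V X. open V \<and> V \<subseteq> U \<and> X \<in> vfields A V \<longrightarrow> smooth_fun A V (\<lambda>p. \<omega> p (X p)))}"

text \<open>Sections over \<open>U\<close> of the bundle of symmetric \<open>(0,2)\<close>-tensors.\<close>
definition sym_forms2 ::
  "('p::topological_space, 'e::euclidean_space) atlas \<Rightarrow> 'p set \<Rightarrow> 'p form2 set" where
  "sym_forms2 A U = {b.
     (\<forall>p\<in>U. \<forall>v\<in>tspace A p. linear_on (tspace A p) (b p v)) \<and>
     (\<forall>p v w. b p v w = b p w v) \<and>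
     (\<forall>p v w. \<not> (p \<in> U \<and> v \<in> tspace A p \<and> w \<in> tspace A p) \<longrightarrow> b p v w = 0) \<and>
     (\<forall>V X Y. open V \<and> V \<subseteq> U \<and> X \<in> vfields A V \<and> Y \<in> vfields A V \<longrightarrow>
        smooth_fun A V (\<lambda>p. b p (X p) (Y p)))}"


subsection \<open>Connections\<close>

text \<open>
  A linear connection on an open set \<open>U\<close>, as an operator on local sections. The second clause says
  that \<open>D X Y\<close> on \<open>V\<close> only depends on \<open>X\<close> and \<open>Y\<close> on \<open>V\<close>.
\<close>
definition is_connection :: "('p::topological_space, 'e::euclidean_space) atlas \<Rightarrow> 'p set \<Rightarrow>
    ('p vfield \<Rightarrow> 'p vfield \<Rightarrow> 'p vfield) \<Rightarrow> bool" where
  "is_connection A U D \<longleftrightarrow> (\<forall>V. open V \<and> V \<subseteq> U \<longrightarrow>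
     (\<forall>X\<in>vfields A V. \<forall>Y\<in>vfields A V. D X Y \<in> vfields A V) \<and>
     (\<forall>X\<in>vfields A V. \<forall>X'\<in>vfields A V. \<forall>Y\<in>vfields A V. \<forall>Y'\<in>vfields A V.
        (\<forall>p\<in>V. X p = X' p \<and> Y p = Y' p) \<longrightarrow> (\<forall>p\<in>V. D X Y p = D X' Y' p)) \<and>
     (\<forall>X\<in>vfields A V. \<forall>X'\<in>vfields A V. \<forall>Y\<in>vfields A V. \<forall>p\<in>V.
        D (\<lambda>q. X q + X' q) Y p = D X Y p + D X' Y p) \<and>
     (\<forall>X\<in>vfields A V. \<forall>Y\<in>vfields A V. \<forall>f. smooth_fun A V f \<longrightarrow> (\<forall>p\<in>V.
        D (\<lambda>q. fscale (f q) (X q)) Y p = fscale (f p) (D X Y p))) \<and>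
     (\<forall>X\<in>vfields A V. \<forall>Y\<in>vfields A V. \<forall>Y'\<in>vfields A V. \<forall>p\<in>V.
        D X (\<lambda>q. Y q + Y' q) p = D X Y p + D X Y' p) \<and>
     (\<forall>X\<in>vfields A V. \<forall>Y\<in>vfields A V. \<forall>f. smooth_fun A V f \<longrightarrow> (\<forall>p\<in>V.
        D X (\<lambda>q. fscale (f q) (Y q)) p = fscale (f p) (D X Y p) + fscale (X p f) (Y p))))"

definition torsion_free :: "('p::topological_space, 'e::euclidean_space) atlas \<Rightarrow> 'p set \<Rightarrow>
    ('p vfield \<Rightarrow> 'p vfield \<Rightarrow> 'p vfield) \<Rightarrow> bool" where
  "torsion_free A U D \<longleftrightarrow> (\<forall>V X Y. open V \<and> V \<subseteq> U \<and> X \<in> vfields A V \<and> Y \<in> vfields A V \<longrightarrow>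
     (\<forall>p\<in>V. D X Y p - D Y X p = lie_bracket A X Y p))"

text \<open>\<open>cov_deriv2 D b X Y Z p\<close> is \<open>(D\<^sub>X b)(Y, Z)\<close> at \<open>p\<close>.\<close>
definition cov_deriv2 :: "('p vfield \<Rightarrow> 'p vfield \<Rightarrow> 'p vfield) \<Rightarrow> 'p form2 \<Rightarrow>
    'p vfield \<Rightarrow> 'p vfield \<Rightarrow> 'p vfield \<Rightarrow> 'p \<Rightarrow> real" where
  "cov_deriv2 D b X Y Z p =
     X p (\<lambda>q. b q (Y q) (Z q)) - b p (D X Y p) (Z p) - b p (Y p) (D X Z p)"

text \<open>\<open>Db = -2 \<theta> \<otimes> b\<close> on \<open>U\<close>; the case \<open>\<theta> = 0\<close> says that \<open>b\<close> is parallel.\<close>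
definition weyl_related :: "('p::topological_space, 'e::euclidean_space) atlas \<Rightarrow> 'p set \<Rightarrow>
    ('p vfield \<Rightarrow> 'p vfield \<Rightarrow> 'p vfield) \<Rightarrow> 'p form2 \<Rightarrow> 'p form1 \<Rightarrow> bool" where
  "weyl_related A U D b \<theta> \<longleftrightarrow> (\<forall>V X Y Z. open V \<and> V \<subseteq> U \<and>
       X \<in> vfields A V \<and> Y \<in> vfields A V \<and> Z \<in> vfields A V \<longrightarrow>
     (\<forall>p\<in>V. cov_deriv2 D b X Y Z p = - 2 * \<theta> p (X p) * b p (Y p) (Z p)))"

definition metric_connection :: "('p::topological_space, 'e::euclidean_space) atlas \<Rightarrow> 'p set \<Rightarrow>
    ('p vfield \<Rightarrow> 'p vfield \<Rightarrow> 'p vfield) \<Rightarrow> 'p form2 \<Rightarrow> bool" where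
  "metric_connection A U D b \<longleftrightarrow> weyl_related A U D b (\<lambda>p v. 0)"


subsection \<open>Lorentzian manifolds and their hypersurfaces\<close>

definition lorentzian_metric ::
  "('q::topological_space, 'e::euclidean_space) atlas \<Rightarrow> 'q form2 \<Rightarrow> bool" where
  "lorentzian_metric B G \<longleftrightarrow> G \<in> sym_forms2 B UNIV \<and>
     (\<forall>p. \<exists>e :: nat \<Rightarrow> 'q tvec.
        (\<forall>i<DIM('e). e i \<in> tspace B p) \<and> fvs.span (e ` {..<DIM('e)}) = tspace B p \<and>
        (\<forall>i<DIM('e). \<forall>j<DIM('e).
           G p (e i) (e j) = (if i \<noteq> j then 0 else if i = 0 then - 1 else 1)))"

definition levi_civita :: "('q::topological_space, 'e::euclidean_space) atlas \<Rightarrow> 'q form2 \<Rightarrow>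
    ('q vfield \<Rightarrow> 'q vfield \<Rightarrow> 'q vfield) \<Rightarrow> bool" where
  "levi_civita B G N \<longleftrightarrow>
     is_connection B UNIV N \<and> torsion_free B UNIV N \<and> metric_connection B UNIV N G"

text \<open>The differential of \<open>\<iota>\<close>.\<close>
definition push :: "('q::topological_space, 'e::euclidean_space) atlas \<Rightarrow> ('p \<Rightarrow> 'q) \<Rightarrow> 'p \<Rightarrow>
    'p tvec \<Rightarrow> 'q tvec" where
  "push B \<iota> p v = (\<lambda>h. if smooth_near B (\<iota> p) h then v (h \<circ> \<iota>) else 0)"

definition immersion :: "('p::topological_space, 'b::euclidean_space) atlas \<Rightarrow>
    ('q::topological_space, 'e::euclidean_space) atlas \<Rightarrow> ('p \<Rightarrow> 'q) \<Rightarrow> bool" where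
  "immersion A B \<iota> \<longleftrightarrow> continuous_on UNIV \<iota> \<and>
     (\<forall>W h. open W \<and> smooth_fun B W h \<longrightarrow> smooth_fun A (\<iota> -` W) (h \<circ> \<iota>)) \<and>
     (\<forall>p. inj_on (push B \<iota> p) (tspace A p))"

definition induced_metric :: "('p::topological_space, 'b::euclidean_space) atlas \<Rightarrow>
    ('q::topological_space, 'e::euclidean_space) atlas \<Rightarrow> ('p \<Rightarrow> 'q) \<Rightarrow> 'q form2 \<Rightarrow> 'p form2" where
  "induced_metric A B \<iota> G = (\<lambda>p v w. if v \<in> tspace A p \<and> w \<in> tspace A p
     then G (\<iota> p) (push B \<iota> p v) (push B \<iota> p w) else 0)"

definition rad :: "('p::topological_space, 'b::euclidean_space) atlas \<Rightarrow> 'p form2 \<Rightarrow> 'p \<Rightarrow> 'p tvec set"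
  where "rad A b p = {v \<in> tspace A p. \<forall>w\<in>tspace A p. b p v w = 0}"

text \<open>
  \<open>w\<close> is the ambient covariant derivative \<open>N\<^sub>X Y\<close> at \<open>p\<close> for vector fields \<open>X, Y\<close> tangent to
  the hypersurface on \<open>U\<close>. If \<open>Y\<close> (seen along \<open>\<iota>\<close>) has an extension \<open>E\<close> to an ambient vector
  field, this is \<open>N\<^sub>Z E\<close> for any \<open>Z\<close> extending \<open>X p\<close> (the case of a single
  summand with coefficient \<open>1\<close>). In general \<open>Y\<close> is locally a combination
  \<open>\<Sum>k. c\<^sub>k (E\<^sub>k \<circ> \<iota>)\<close> of ambient fields, e.g. the coordinate fields of a chart, and the value
  is determined by the Leibniz rule, independently of the chosen combination.
\<close>
definition ambient_deriv :: "('p::topological_space, 'b::euclidean_space) atlas \<Rightarrow>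
    ('q::topological_space, 'e::euclidean_space) atlas \<Rightarrow> ('p \<Rightarrow> 'q) \<Rightarrow>
    ('q vfield \<Rightarrow> 'q vfield \<Rightarrow> 'q vfield) \<Rightarrow>
    'p set \<Rightarrow> 'p vfield \<Rightarrow> 'p vfield \<Rightarrow> 'p \<Rightarrow> 'q tvec \<Rightarrow> bool" where
  "ambient_deriv A B \<iota> N U X Y p w \<longleftrightarrow>
     (\<exists>W (m::nat) c E Z. open W \<and> \<iota> ` U \<subseteq> W \<and>
        (\<forall>k<m. smooth_fun A U (c k) \<and> E k \<in> vfields B W) \<and>
        (\<forall>q\<in>U. push B \<iota> q (Y q) = (\<Sum>k<m. fscale (c k q) (E k (\<iota> q)))) \<and>
        Z \<in> vfields B W \<and> Z (\<iota> p) = push B \<iota> p (X p) \<and>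
        w = (\<Sum>k<m. fscale (X p (c k)) (E k (\<iota> p)) + fscale (c k p) (N Z (E k) (\<iota> p))))"

definition totally_geodesic :: "('p::topological_space, 'b::euclidean_space) atlas \<Rightarrow>
    ('q::topological_space, 'e::euclidean_space) atlas \<Rightarrow> ('p \<Rightarrow> 'q) \<Rightarrow> 'q form2 \<Rightarrow>
    ('q vfield \<Rightarrow> 'q vfield \<Rightarrow> 'q vfield) \<Rightarrow> bool" where
  "totally_geodesic A B \<iota> G N \<longleftrightarrow>
     (\<forall>U X Y p w \<xi>. open U \<and> X \<in> vfields A U \<and> Y \<in> vfields A U \<and> p \<in> U \<and>
        ambient_deriv A B \<iota> N U X Y p w \<and> \<xi> \<in> rad A (induced_metric A B \<iota> G) p \<longrightarrow>
        G (\<iota> p) w (push B \<iota> p \<xi>) = 0)"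

definition lightlike_hypersurface ::
  "nat \<Rightarrow> ('p::{t2_space, second_countable_topology}, 'b::euclidean_space) atlas \<Rightarrow>
    ('q::{t2_space, second_countable_topology}, 'e::euclidean_space) atlas \<Rightarrow>
    ('p \<Rightarrow> 'q) \<Rightarrow> 'q form2 \<Rightarrow> bool" where
  "lightlike_hypersurface n A B \<iota> G \<longleftrightarrow>
     smooth_atlas A \<and> smooth_atlas B \<and> DIM('b) = n + 1 \<and> DIM('e) = n + 2 \<and>
     lorentzian_metric B G \<and> immersion A B \<iota> \<and>
     (\<forall>p. form_rank (tspace A p) (induced_metric A B \<iota> G p) = n)"


subsection \<open>Screen distributions\<close>

definition sections :: "('p::topological_space, 'b::euclidean_space) atlas \<Rightarrow>
    ('p \<Rightarrow> 'p tvec set) \<Rightarrow> 'p set \<Rightarrow> 'p vfield set" where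
  "sections A \<S> V = {X \<in> vfields A V. \<forall>p\<in>V. X p \<in> \<S> p}"

definition distribution :: "('p::topological_space, 'b::euclidean_space) atlas \<Rightarrow> nat \<Rightarrow>
    ('p \<Rightarrow> 'p tvec set) \<Rightarrow> bool" where
  "distribution A n \<S> \<longleftrightarrow> (\<forall>p. \<exists>V. open V \<and> p \<in> V \<and>
     (\<exists>E :: nat \<Rightarrow> 'p vfield. (\<forall>k<n. E k \<in> vfields A V) \<and>
        (\<forall>q\<in>V. \<S> q = fvs.span ((\<lambda>k. E k q) ` {..<n}) \<and> fvs.dim (\<S> q) = n)))"

definition screen_distribution :: "('p::topological_space, 'b::euclidean_space) atlas \<Rightarrow> nat \<Rightarrow>
    'p form2 \<Rightarrow> ('p \<Rightarrow> 'p tvec set) \<Rightarrow> bool" where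
  "screen_distribution A n g0 \<S> \<longleftrightarrow> distribution A n \<S> \<and>
     (\<forall>p. \<S> p \<inter> rad A g0 p = {0} \<and> {s + r |s r. s \<in> \<S> p \<and> r \<in> rad A g0 p} = tspace A p)"

text \<open>
  Integrability of a distribution of codimension one: locally there is a foliation by level sets
  of a smooth function \<open>z\<close> whose tangent spaces are \<open>\<S>\<close>.
\<close>
definition integrable_hyperplanes :: "('p::topological_space, 'b::euclidean_space) atlas \<Rightarrow>
    ('p \<Rightarrow> 'p tvec set) \<Rightarrow> bool" where
  "integrable_hyperplanes A \<S> \<longleftrightarrow> (\<forall>p. \<exists>V z. open V \<and> p \<in> V \<and> smooth_fun A V z \<and>
     (\<forall>q\<in>V. (\<exists>v\<in>tspace A q. v z \<noteq> 0) \<and> \<S> q = {v \<in> tspace A q. v z = 0}))"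

text \<open>\<open>P : TM \<rightarrow> S(TM)\<close> along the radical.\<close>
definition screen_proj :: "('p::topological_space, 'b::euclidean_space) atlas \<Rightarrow> 'p form2 \<Rightarrow>
    ('p \<Rightarrow> 'p tvec set) \<Rightarrow> 'p \<Rightarrow> 'p tvec \<Rightarrow> 'p tvec" where
  "screen_proj A g0 \<S> p v = (THE s. s \<in> \<S> p \<and> v - s \<in> rad A g0 p)"

abbreviation screen_part :: "('p::topological_space, 'b::euclidean_space) atlas \<Rightarrow> 'p form2 \<Rightarrow>
    ('p \<Rightarrow> 'p tvec set) \<Rightarrow> 'p vfield \<Rightarrow> 'p vfield" where
  "screen_part A g0 \<S> Y \<equiv> (\<lambda>q. screen_proj A g0 \<S> q (Y q))"

text \<open>
  The \<open>1\<close>-form on \<open>U\<close> with \<open>\<eta>(\<xi>) = 1\<close> and kernel \<open>S(TM)\<close>; these conditions determine \<open>\<eta>\<close>.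
\<close>
definition screen_form :: "('p::topological_space, 'b::euclidean_space) atlas \<Rightarrow>
    ('p \<Rightarrow> 'p tvec set) \<Rightarrow> 'p set \<Rightarrow> 'p vfield \<Rightarrow> 'p form1 \<Rightarrow> bool" where
  "screen_form A \<S> U \<xi> \<eta> \<longleftrightarrow> \<eta> \<in> forms1 A U \<and>
     (\<forall>p\<in>U. \<eta> p (\<xi> p) = 1 \<and> {v \<in> tspace A p. \<eta> p v = 0} = \<S> p)"

definition sharp :: "('p::topological_space, 'b::euclidean_space) atlas \<Rightarrow> 'p form2 \<Rightarrow>
    'p form1 \<Rightarrow> 'p form1 \<Rightarrow> 'p vfield" where
  "sharp A g \<eta> \<omega> p =
     (THE v. v \<in> tspace A p \<and> (\<forall>w\<in>tspace A p. \<omega> p w = g p v w + \<eta> p v * \<eta> p w))"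

text \<open>
  \<open>C\<close> is the second fundamental form on \<open>U\<close>: \<open>D\<^sup>g\<^sub>X PY\<close> is \<open>C(X, PY) \<xi>\<close> plus a
  vector in \<open>S(TM)\<close>. Only the values of \<open>C\<close> on \<open>TM \<times> S(TM)\<close> are determined.
\<close>
definition screen_second_form :: "('p::topological_space, 'b::euclidean_space) atlas \<Rightarrow>
    'p form2 \<Rightarrow> ('p \<Rightarrow> 'p tvec set) \<Rightarrow> 'p set \<Rightarrow> 'p vfield \<Rightarrow>
    ('p vfield \<Rightarrow> 'p vfield \<Rightarrow> 'p vfield) \<Rightarrow> 'p form2 \<Rightarrow> bool" where
  "screen_second_form A g0 \<S> U \<xi> Dg C \<longleftrightarrow>
     (\<forall>V X Y. open V \<and> V \<subseteq> U \<and> X \<in> vfields A V \<and> Y \<in> vfields A V \<longrightarrow>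
        (\<exists>Z\<in>sections A \<S> V. \<forall>p\<in>V. Dg X (screen_part A g0 \<S> Y) p =
           Z p + fscale (C p (X p) (screen_proj A g0 \<S> p (Y p))) (\<xi> p)))"


subsection \<open>Conformal class, Weyl structures\<close>

definition conf_class ::
  "('p::topological_space, 'b::euclidean_space) atlas \<Rightarrow> 'p form2 \<Rightarrow> 'p form2 set" where
  "conf_class A g0 = {g. \<exists>f. smooth_fun A UNIV f \<and> (\<forall>p. \<forall>v\<in>rad A g0 p. v f = 0) \<and>
     g = (\<lambda>p v w. exp (- 2 * f p) * g0 p v w)}"

definition weyl_structure :: "('p::topological_space, 'b::euclidean_space) atlas \<Rightarrow> 'p form2 set \<Rightarrow>
    ('p vfield \<Rightarrow> 'p vfield \<Rightarrow> 'p vfield) \<Rightarrow> bool" where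
  "weyl_structure A c D \<longleftrightarrow> is_connection A UNIV D \<and> torsion_free A UNIV D \<and>
     (\<forall>g\<in>c. \<exists>!\<theta>. \<theta> \<in> forms1 A UNIV \<and> weyl_related A UNIV D g \<theta>)"

definition weyl_form :: "('p::topological_space, 'b::euclidean_space) atlas \<Rightarrow>
    ('p vfield \<Rightarrow> 'p vfield \<Rightarrow> 'p vfield) \<Rightarrow> 'p form2 \<Rightarrow> 'p form1" where
  "weyl_form A D g = (THE \<theta>. \<theta> \<in> forms1 A UNIV \<and> weyl_related A UNIV D g \<theta>)"

definition weyl_screen_structure :: "('p::topological_space, 'b::euclidean_space) atlas \<Rightarrow>
    'p form2 \<Rightarrow> ('p \<Rightarrow> 'p tvec set) \<Rightarrow> ('p vfield \<Rightarrow> 'p vfield \<Rightarrow> 'p vfield) \<Rightarrow> bool" where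
  "weyl_screen_structure A g0 \<S> D \<longleftrightarrow> weyl_structure A (conf_class A g0) D \<and>
     (\<forall>V X Y. open V \<and> X \<in> vfields A V \<and> Y \<in> vfields A V \<longrightarrow>
        D X (screen_part A g0 \<S> Y) \<in> sections A \<S> V)"

text \<open>\<open>\<Omega>\<^sup>1\<^sub>h\<^sub>o\<^sub>r\<close> on the open set \<open>U\<close>.\<close>
definition hor_forms1 :: "('p::topological_space, 'b::euclidean_space) atlas \<Rightarrow> 'p form2 \<Rightarrow>
    'p set \<Rightarrow> 'p form1 set" where
  "hor_forms1 A g0 U = {\<omega> \<in> forms1 A U. \<forall>p\<in>U. \<forall>v\<in>rad A g0 p. \<omega> p v = 0}"

text \<open>
  \<open>D\<^sub>X Y = D\<^sup>g\<^sub>X Y + \<theta>(X) Y + \<theta>(Y) X - g(X, Y) \<theta>\<^sup>\<sharp> - S(X, Y) \<xi>\<close> on \<open>U\<close>.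
\<close>
definition weyl_formula :: "('p::topological_space, 'b::euclidean_space) atlas \<Rightarrow> 'p set \<Rightarrow>
    ('p vfield \<Rightarrow> 'p vfield \<Rightarrow> 'p vfield) \<Rightarrow> ('p vfield \<Rightarrow> 'p vfield \<Rightarrow> 'p vfield) \<Rightarrow>
    'p form2 \<Rightarrow> 'p form1 \<Rightarrow> 'p vfield \<Rightarrow> 'p form1 \<Rightarrow> 'p form2 \<Rightarrow> bool" where
  "weyl_formula A U D Dg g \<eta> \<xi> \<theta> S \<longleftrightarrow>
     (\<forall>V X Y. open V \<and> V \<subseteq> U \<and> X \<in> vfields A V \<and> Y \<in> vfields A V \<longrightarrow> (\<forall>p\<in>V.
        D X Y p = Dg X Y p + fscale (\<theta> p (X p)) (Y p) + fscale (\<theta> p (Y p)) (X p)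
          - fscale (g p (X p) (Y p)) (sharp A g \<eta> \<theta> p) - fscale (S p (X p) (Y p)) (\<xi> p)))"

end

theory Submission
  imports Defs
begin

text \<open>
  Let \<open>v\<close> be radical at \<open>p\<close>, extended to a vector field \<open>X\<close>. Torsion-freeness and \<open>Dg = -2\<theta> \<otimes> g\<close> express
  \<open>-2\<theta>(v) g(Y, Y)\<close> at \<open>p\<close> as \<open>X g(Y, Y) - 2 g([X, Y], Y) - 2 Y g(X, Y)\<close>. Computed with the ambient
  Levi-Civita derivative, this is \<open>-2 G(X, \<nabla>\<^sub>Y Y)\<close>, which vanishes by total geodesicity. Hence \<open>\<theta>\<close> is
  horizontal as soon as \<open>g \<noteq> 0\<close> at \<open>p\<close>; if \<open>g\<close> vanishes somewhere then \<open>n = 0\<close>, every form is a Weyl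
  form, and uniqueness leaves only \<open>\<theta> = 0\<close>.

  For the formula, \<open>\<Delta> = D\<^sup>g - D\<close> is a symmetric tensor, and the Koszul trick determines \<open>g(\<Delta>(X, Y), Z)\<close>
  from \<open>\<theta>\<close>. Therefore \<open>\<Delta>(X, Y) + \<theta>(X) Y + \<theta>(Y) X - g(X, Y) \<theta>\<^sup>\<sharp>\<close> is radical, i.e. a multiple of \<open>\<xi>\<close>, and
  applying \<open>\<eta>\<close> reads off the factor \<open>S(X, Y) = \<eta>(\<Delta>(X, Y)) + \<theta>(X) \<eta>(Y) + \<theta>(Y) \<eta>(X)\<close>.
\<close>

subsection \<open>Calculus of smooth functions\<close>

text \<open>Since \<open>\<iota>\<close> is only an immersion, a field tangent to the hypersurface
  need not extend to an ambient field. Its ambient derivative is therefore computed in an ambient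
  coordinate frame along \<open>\<iota>\<close>, with coefficients that are functions on the
  hypersurface; torsion-freeness and metric compatibility have to be recovered for this expression
  by hand. The connections are operators on local fields without any pointwise meaning, whereas
  \<open>S\<close> has to be a tensor at each point. A frame expansion of both connections provides
  the passage: the terms that differentiate coefficients are the same for both. Tangent vectors are
  functionals on functions, given through charts. Chart independence, locality and the Leibniz rule
  thus have to come out of coordinate calculus before any geometry can start. All of this is needed
  only near one point, so fields are shrunk to common neighbourhoods throughout, and each vector at
  a point is extended with constant coefficients in a frame.\<close>

lemma Ck_on_subset: "Ck_on k f S \<Longrightarrow> T \<subseteq> S \<Longrightarrow> Ck_on k f T"
  by (induction k arbitrary: f) (auto intro: continuous_on_subset)

text \<open>\<open>frechet_derivative\<close> chooses among all derivatives at the point. Functions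
  that agree nearby admit the same derivatives, so the choice is the same even where none
  exists.\<close>

lemma frechet_derivative_cong_open:
  assumes "open S" "x \<in> S" "\<And>y. y \<in> S \<Longrightarrow> f y = g y"
  shows "frechet_derivative f (at x) = frechet_derivative g (at x)"
proof -
  have "(f has_derivative D) (at x) \<longleftrightarrow> (g has_derivative D) (at x)" for D
    using assms has_derivative_transform_within_open[of f D x UNIV S g]
      has_derivative_transform_within_open[of g D x UNIV S f] by auto
  then show ?thesis unfolding frechet_derivative_def by presburger
qed

lemma differentiable_cong_open:
  assumes "open S" "x \<in> S" "\<And>y. y \<in> S \<Longrightarrow> f y = g y" "f differentiable (at x)"
  shows "g differentiable (at x)"
  using assms has_derivative_transform_within_open[of f _ x UNIV S g]
  unfolding differentiable_def by blast

lemma Ck_on_cong: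
  assumes "open S" "\<And>y. y \<in> S \<Longrightarrow> f y = g y" "Ck_on k f S"
  shows "Ck_on k g S"
  using assms(2,3)
proof (induction k arbitrary: f g)
  case 0
  then show ?case using continuous_on_cong[of S S f g] by simp
next
  case (Suc k)
  have "g differentiable (at x)" if "x \<in> S" for x
    using differentiable_cong_open[OF assms(1) that, of f g] Suc.prems that by auto
  moreover have "Ck_on k (\<lambda>x. frechet_derivative g (at x) w) S" for w
  proof (rule Suc.IH)
    show "Ck_on k (\<lambda>x. frechet_derivative f (at x) w) S" using Suc.prems by simp
    show "frechet_derivative f (at y) w = frechet_derivative g (at y) w" if "y \<in> S" for y
      using frechet_derivative_cong_open[OF assms(1) that, of f g] Suc.prems by simp
  qed
  ultimately show ?case by simp
qed

lemma Ck_on_Suc_imp: "Ck_on (Suc k) f S \<Longrightarrow> Ck_on k f S"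
proof (induction k arbitrary: f)
  case 0
  then show ?case
    by (auto intro!: continuous_at_imp_continuous_on differentiable_imp_continuous_within)
qed auto

text \<open>Derivatives are unique, so any explicit candidate \<open>D\<close> may replace the
  choice inside \<open>frechet_derivative\<close>; this is the introduction rule behind all the
  closure properties that follow.\<close>

lemma Ck_on_SucI:
  assumes S: "open S" and f: "\<And>x. x \<in> S \<Longrightarrow> (f has_derivative D x) (at x)"
    and D: "\<And>w. Ck_on k (\<lambda>x. D x w) S"
  shows "Ck_on (Suc k) f S"
proof -
  have "frechet_derivative f (at x) = D x" if "x \<in> S" for x
    using frechet_derivative_at[OF f[OF that]] by simp
  then have "Ck_on k (\<lambda>x. frechet_derivative f (at x) w) S" for w
    using Ck_on_cong[OF S _ D[of w]] by simp
  then show ?thesis using f by (auto simp: differentiable_def)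
qed

lemma Ck_on_SucD:
  assumes "Ck_on (Suc k) f S"
  shows "x \<in> S \<Longrightarrow> (f has_derivative frechet_derivative f (at x)) (at x)"
    "Ck_on k (\<lambda>x. frechet_derivative f (at x) w) S"
  using assms by (auto simp: frechet_derivative_works[symmetric])

lemma Ck_on_const: "open S \<Longrightarrow> Ck_on k (\<lambda>x. c) S"
proof (induction k arbitrary: c)
  case (Suc k)
  show ?case by (rule Ck_on_SucI[where D="\<lambda>x w. 0"]) (use Suc in auto)
qed auto

lemma Ck_on_add: "open S \<Longrightarrow> Ck_on k f S \<Longrightarrow> Ck_on k g S \<Longrightarrow> Ck_on k (\<lambda>x. f x + g x) S"
proof (induction k arbitrary: f g)
  case (Suc k)
  note f = Ck_on_SucD[OF Suc.prems(2)] and g = Ck_on_SucD[OF Suc.prems(3)]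
  show ?case
    by (rule Ck_on_SucI[OF Suc.prems(1) has_derivative_add[OF f(1) g(1)]])
      (use f g Suc in auto)
qed (auto intro: continuous_intros)

lemma Ck_on_sum:
  "open S \<Longrightarrow> (\<And>i. i \<in> I \<Longrightarrow> Ck_on k (f i) S) \<Longrightarrow> Ck_on k (\<lambda>x. \<Sum>i\<in>I. f i x) S"
  by (induction I rule: infinite_finite_induct) (auto simp: Ck_on_const intro!: Ck_on_add)

lemma Ck_on_bounded_linear:
  assumes L: "bounded_linear L"
  shows "open S \<Longrightarrow> Ck_on k f S \<Longrightarrow> Ck_on k (\<lambda>x. L (f x)) S"
proof (induction k arbitrary: f)
  case 0
  then show ?case using bounded_linear.continuous_on[OF L] by auto
next
  case (Suc k)
  note f = Ck_on_SucD[OF Suc.prems(2)]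
  show ?case
    by (rule Ck_on_SucI[OF Suc.prems(1) bounded_linear.has_derivative[OF L f(1)]])
      (use f Suc in auto)
qed

lemma Ck_on_scaleR:
  "open S \<Longrightarrow> Ck_on k c S \<Longrightarrow> Ck_on k f S \<Longrightarrow> Ck_on k (\<lambda>x. c x *\<^sub>R f x) S"
proof (induction k arbitrary: c f)
  case (Suc k)
  note c = Ck_on_SucD[OF Suc.prems(2)] and f = Ck_on_SucD[OF Suc.prems(3)]
  show ?case
    by (rule Ck_on_SucI[OF Suc.prems(1) has_derivative_scaleR[OF c(1) f(1)]])
      (assumption | rule Ck_on_add Suc.IH c(2) f(2) Suc.prems(1) Ck_on_Suc_imp[OF Suc.prems(2)]
        Ck_on_Suc_imp[OF Suc.prems(3)])+
qed (auto intro: continuous_intros)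

lemma Ck_on_compose:
  fixes f :: "'f::euclidean_space \<Rightarrow> 'g::real_normed_vector"
    and g :: "'e::euclidean_space \<Rightarrow> 'f"
  assumes S: "open S" and T: "open T" and gST: "g ` S \<subseteq> T"
  shows "Ck_on k f T \<Longrightarrow> Ck_on k g S \<Longrightarrow> Ck_on k (f \<circ> g) S"
proof (induction k arbitrary: f)
  case 0
  then show ?case
    using gST by (auto intro: continuous_on_compose[of S g f] continuous_on_subset simp del: o_apply)
next
  case (Suc k)
  note f = Ck_on_SucD[OF Suc.prems(1)] and g = Ck_on_SucD[OF Suc.prems(2)]
  \<comment> \<open>The chain rule yields a composition of linear maps, to which the induction
    hypothesis does not apply. Expanding the inner derivative in the basis turns it into a sum of
    products of scalar functions with directional derivatives of \<open>f\<close> composed with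
    \<open>g\<close>.\<close>
  let ?D = "\<lambda>x w. \<Sum>b\<in>Basis. (frechet_derivative g (at x) w \<bullet> b) *\<^sub>R
    frechet_derivative f (at (g x)) b"
  have "(f \<circ> g has_derivative ?D x) (at x)" if x: "x \<in> S" for x
  proof -
    have "g x \<in> T" using gST x by auto
    then have f': "(f has_derivative frechet_derivative f (at (g x))) (at (g x))" using f(1) by auto
    then have lin: "linear (frechet_derivative f (at (g x)))"
      by (rule has_derivative_linear)
    have expand: "frechet_derivative f (at (g x)) v = (\<Sum>b\<in>Basis. (v \<bullet> b) *\<^sub>R frechet_derivative f (at (g x)) b)"
      for v
    proof -
      have "frechet_derivative f (at (g x)) (\<Sum>b\<in>Basis. (v \<bullet> b) *\<^sub>R b) =
          (\<Sum>b\<in>Basis. (v \<bullet> b) *\<^sub>R frechet_derivative f (at (g x)) b)"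
        by (simp only: linear_sum[OF lin] linear_cmul[OF lin])
      then show ?thesis by (simp add: euclidean_representation)
    qed
    have "frechet_derivative f (at (g x)) \<circ> frechet_derivative g (at x) = ?D x"
      by (rule ext, subst o_apply, rule expand)
    then show ?thesis using diff_chain_at[OF g(1)[OF x] f'] by simp
  qed
  moreover have "Ck_on k (\<lambda>x. ?D x w) S" for w
  proof (intro Ck_on_sum Ck_on_scaleR S)
    fix b :: 'f
    show "Ck_on k (\<lambda>x. frechet_derivative g (at x) w \<bullet> b) S"
      using g(2) by (rule Ck_on_bounded_linear[OF bounded_linear_inner_left S])
    have "Ck_on k ((\<lambda>y. frechet_derivative f (at y) b) \<circ> g) S"
      by (rule Suc.IH[OF f(2) Ck_on_Suc_imp[OF Suc.prems(2)]])
    then show "Ck_on k (\<lambda>x. frechet_derivative f (at (g x)) b) S" by (simp add: o_def)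
  qed
  ultimately show ?case by (rule Ck_on_SucI[OF S])
qed

text \<open>The constant \<open>c\<close> is there for the induction: differentiating in direction
  \<open>w\<close> reproduces the same shape with \<open>c * w\<close>.\<close>

lemma Ck_on_exp: "Ck_on k (\<lambda>x::real. c * exp x) UNIV"
proof (induction k arbitrary: c)
  case (Suc k)
  show ?case
  proof (rule Ck_on_SucI[where D="\<lambda>x w. c * (w * exp x)"])
    show "((\<lambda>x. c * exp x) has_derivative (\<lambda>w. c * (w * exp x))) (at x)" for x
      by (auto intro!: derivative_eq_intros)
    show "Ck_on k (\<lambda>x. c * (w * exp x)) UNIV" for w
      using Suc[of "c * w"] by (simp add: mult.assoc)
  qed auto
qed (auto intro!: continuous_intros)

lemma Cinf_on_cong: "open S \<Longrightarrow> (\<And>y. y \<in> S \<Longrightarrow> f y = g y) \<Longrightarrow> Cinf_on f S \<Longrightarrow> Cinf_on g S"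
  unfolding Cinf_on_def using Ck_on_cong by blast

lemma Cinf_on_subset: "Cinf_on f S \<Longrightarrow> T \<subseteq> S \<Longrightarrow> Cinf_on f T"
  unfolding Cinf_on_def using Ck_on_subset by blast

lemma Cinf_on_const: "open S \<Longrightarrow> Cinf_on (\<lambda>x. c) S"
  unfolding Cinf_on_def using Ck_on_const by blast

lemma Cinf_on_add: "open S \<Longrightarrow> Cinf_on f S \<Longrightarrow> Cinf_on g S \<Longrightarrow> Cinf_on (\<lambda>x. f x + g x) S"
  unfolding Cinf_on_def using Ck_on_add by blast

lemma Cinf_on_mult:
  fixes f g :: "_ \<Rightarrow> real"
  shows "open S \<Longrightarrow> Cinf_on f S \<Longrightarrow> Cinf_on g S \<Longrightarrow> Cinf_on (\<lambda>x. f x * g x) S"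
  unfolding Cinf_on_def using Ck_on_scaleR[of S _ f g] by simp

lemma Cinf_on_bounded_linear:
  "bounded_linear L \<Longrightarrow> open S \<Longrightarrow> Cinf_on f S \<Longrightarrow> Cinf_on (\<lambda>x. L (f x)) S"
  unfolding Cinf_on_def using Ck_on_bounded_linear by blast

lemma Cinf_on_compose:
  "open S \<Longrightarrow> open T \<Longrightarrow> g ` S \<subseteq> T \<Longrightarrow> Cinf_on f T \<Longrightarrow> Cinf_on g S \<Longrightarrow> Cinf_on (f \<circ> g) S"
  unfolding Cinf_on_def using Ck_on_compose by blast

lemma Cinf_on_exp: "Cinf_on (exp :: real \<Rightarrow> real) UNIV"
  unfolding Cinf_on_def using Ck_on_exp[of _ 1] by simp

lemma Cinf_on_derivative: "Cinf_on f S \<Longrightarrow> Cinf_on (\<lambda>x. frechet_derivative f (at x) w) S"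
  unfolding Cinf_on_def using Ck_on_SucD(2) by blast

lemma Cinf_on_has_derivative:
  "Cinf_on f S \<Longrightarrow> x \<in> S \<Longrightarrow> (f has_derivative frechet_derivative f (at x)) (at x)"
  unfolding Cinf_on_def using Ck_on_SucD(1) by blast

subsection \<open>Tangent vectors and vector fields\<close>

lemma sum_fun_apply [simp]: "(\<Sum>i\<in>I. f i) x = (\<Sum>i\<in>I. f i x :: real)"
  by (induction I rule: infinite_finite_induct) auto

lemma fscale_apply [simp]: "fscale a f x = a * f x"
  by (simp add: fscale_def)

section \<open>Charts and smooth functions on a manifold\<close>

locale smooth_mfd =
  fixes A :: "('p::{t2_space, second_countable_topology}, 'b::euclidean_space) atlas"
  assumes atlas: "smooth_atlas A"
begin

lemma ex_chart: obtains W \<phi> where "(W, \<phi>) \<in> A" "p \<in> W"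
proof -
  have "p \<in> (\<Union>(W, \<phi>)\<in>A. W)" using atlas unfolding smooth_atlas_def by simp
  then show thesis using that by auto
qed

lemma chart:
  assumes "(W, \<phi>) \<in> A"
  shows "open W" "homeomorphism W (\<phi> ` W) \<phi> (inv_into W \<phi>)"
    "\<And>p. p \<in> W \<Longrightarrow> inv_into W \<phi> (\<phi> p) = p"
    "\<And>V. open V \<Longrightarrow> open (\<phi> ` (V \<inter> W))"
proof -
  show o: "open W" and h: "homeomorphism W (\<phi> ` W) \<phi> (inv_into W \<phi>)"
    using atlas assms unfolding smooth_atlas_def by auto
  show "inv_into W \<phi> (\<phi> p) = p" if "p \<in> W" for p
    using h that by (auto simp: homeomorphism_def)
  show "open (\<phi> ` (V \<inter> W))" if V: "open V" for V
  proof -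
    have "open (\<phi> ` W)" using atlas assms unfolding smooth_atlas_def by auto
    moreover have "openin (top_of_set (\<phi> ` W)) (\<phi> ` (V \<inter> W))"
      using V o by (intro homeomorphism_imp_open_map[OF h]) (auto simp: openin_open_eq)
    ultimately show ?thesis using openin_open_trans by blast
  qed
qed

lemma transition_smooth:
  assumes "(W, \<phi>) \<in> A" "(W', \<phi>') \<in> A"
  shows "Cinf_on (\<phi> \<circ> inv_into W' \<phi>') (\<phi>' ` (W \<inter> W'))"
  using assms atlas unfolding smooth_atlas_def by (fastforce simp: Int_commute)

lemma smooth_funD: "smooth_fun A V h \<Longrightarrow> (W, \<phi>) \<in> A \<Longrightarrow> Cinf_on (h \<circ> inv_into W \<phi>) (\<phi> ` (V \<inter> W))"
  unfolding smooth_fun_def by auto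

lemma smooth_fun_cong:
  assumes "open V" "\<And>q. q \<in> V \<Longrightarrow> f q = g q" "smooth_fun A V f"
  shows "smooth_fun A V g"
  unfolding smooth_fun_def
proof clarify
  fix W \<phi> assume c: "(W, \<phi>) \<in> A"
  show "Cinf_on (g \<circ> inv_into W \<phi>) (\<phi> ` (V \<inter> W))"
    by (rule Cinf_on_cong[OF chart(4)[OF c assms(1)] _ smooth_funD[OF assms(3) c]])
      (use assms(2) chart(3)[OF c] in auto)
qed

lemma smooth_fun_subset: "smooth_fun A V h \<Longrightarrow> V' \<subseteq> V \<Longrightarrow> smooth_fun A V' h"
  unfolding smooth_fun_def by (fastforce intro: Cinf_on_subset)

lemma smooth_fun_const: "open V \<Longrightarrow> smooth_fun A V (\<lambda>q. c)"
  unfolding smooth_fun_def o_def by (auto intro!: Cinf_on_const chart(4))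

lemma smooth_fun_add:
  "open V \<Longrightarrow> smooth_fun A V f \<Longrightarrow> smooth_fun A V g \<Longrightarrow> smooth_fun A V (\<lambda>q. f q + g q)"
  unfolding smooth_fun_def o_def by (auto intro!: Cinf_on_add chart(4))

lemma smooth_fun_mult:
  "open V \<Longrightarrow> smooth_fun A V f \<Longrightarrow> smooth_fun A V g \<Longrightarrow> smooth_fun A V (\<lambda>q. f q * g q)"
  unfolding smooth_fun_def o_def by (auto intro!: Cinf_on_mult chart(4))

lemma smooth_fun_diff:
  "open V \<Longrightarrow> smooth_fun A V f \<Longrightarrow> smooth_fun A V g \<Longrightarrow> smooth_fun A V (\<lambda>q. f q - g q)"
  using smooth_fun_add[OF _ _ smooth_fun_mult[OF _ smooth_fun_const], of V f g "-1"] by simp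

lemma smooth_fun_exp:
  assumes V: "open V" and f: "smooth_fun A V f"
  shows "smooth_fun A V (\<lambda>q. exp (f q))"
  unfolding smooth_fun_def
proof clarify
  fix W \<phi> assume c: "(W, \<phi>) \<in> A"
  show "Cinf_on ((\<lambda>q. exp (f q)) \<circ> inv_into W \<phi>) (\<phi> ` (V \<inter> W))"
    using Cinf_on_compose[OF chart(4)[OF c V] open_UNIV _ Cinf_on_exp smooth_funD[OF f c]]
    by (simp add: o_def)
qed

text \<open>Smooth transition maps carry smoothness from one chart to every other, so inside one
  chart domain only that chart has to be checked.\<close>

lemma smooth_fun_chartI:
  assumes c: "(W, \<phi>) \<in> A" and V: "open V" "V \<subseteq> W"
    and f: "Cinf_on (f \<circ> inv_into W \<phi>) (\<phi> ` V)"
  shows "smooth_fun A V f"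
  unfolding smooth_fun_def
proof clarify
  fix W' \<phi>' assume c': "(W', \<phi>') \<in> A"
  have o: "open (\<phi>' ` (V \<inter> W'))" "open (\<phi> ` V)"
    using chart(4)[OF c' V(1)] chart(4)[OF c V(1)] V(2) by (auto simp: Int_absorb2)
  have "Cinf_on ((f \<circ> inv_into W \<phi>) \<circ> (\<phi> \<circ> inv_into W' \<phi>')) (\<phi>' ` (V \<inter> W'))"
  proof (rule Cinf_on_compose[OF o _ f])
    show "(\<phi> \<circ> inv_into W' \<phi>') ` \<phi>' ` (V \<inter> W') \<subseteq> \<phi> ` V"
      using chart(3)[OF c'] by auto
    show "Cinf_on (\<phi> \<circ> inv_into W' \<phi>') (\<phi>' ` (V \<inter> W'))"
      by (rule Cinf_on_subset[OF transition_smooth[OF c c']]) (use V in auto)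
  qed
  then show "Cinf_on (f \<circ> inv_into W' \<phi>') (\<phi>' ` (V \<inter> W'))"
    by (rule Cinf_on_cong[OF o(1), rotated]) (use chart(3)[OF c'] chart(3)[OF c] V in auto)
qed

lemma smooth_nearI: "smooth_fun A V h \<Longrightarrow> open V \<Longrightarrow> p \<in> V \<Longrightarrow> smooth_near A p h"
  unfolding smooth_near_def by auto

lemma smooth_near_common:
  assumes "smooth_near A p f" "smooth_near A p g"
  obtains V where "open V" "p \<in> V" "smooth_fun A V f" "smooth_fun A V g"
proof -
  obtain V V' where "open V" "p \<in> V" "smooth_fun A V f" "open V'" "p \<in> V'" "smooth_fun A V' g"
    using assms unfolding smooth_near_def by auto
  then show thesis
    using smooth_fun_subset[of V f "V \<inter> V'"] smooth_fun_subset[of V' g "V \<inter> V'"]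
    by (intro that[of "V \<inter> V'"]) auto
qed

lemma smooth_near_cong:
  assumes "open V" "p \<in> V" "\<And>q. q \<in> V \<Longrightarrow> f q = g q" "smooth_near A p f"
  shows "smooth_near A p g"
proof -
  obtain V' where V': "open V'" "p \<in> V'" "smooth_fun A V' f"
    using assms(4) unfolding smooth_near_def by auto
  have "smooth_fun A (V \<inter> V') g"
    by (rule smooth_fun_cong[of _ f]) (use assms V' smooth_fun_subset in auto)
  then show ?thesis using assms V' by (auto intro: smooth_nearI)
qed

lemma smooth_near_add:
  "smooth_near A p f \<Longrightarrow> smooth_near A p g \<Longrightarrow> smooth_near A p (\<lambda>q. f q + g q)"
  by (erule (1) smooth_near_common) (auto intro: smooth_nearI smooth_fun_add)

lemma smooth_near_mult:
  "smooth_near A p f \<Longrightarrow> smooth_near A p g \<Longrightarrow> smooth_near A p (\<lambda>q. f q * g q)"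
  by (erule (1) smooth_near_common) (auto intro: smooth_nearI smooth_fun_mult)

lemma smooth_near_const: "smooth_near A p (\<lambda>q. c)"
  using smooth_nearI[OF smooth_fun_const] by blast

lemma smooth_near_sum:
  "(\<And>i. i \<in> I \<Longrightarrow> smooth_near A p (f i)) \<Longrightarrow> smooth_near A p (\<lambda>q. \<Sum>i\<in>I. f i q)"
  by (induction I rule: infinite_finite_induct) (auto simp: smooth_near_const intro!: smooth_near_add)

section \<open>Coordinate vectors and tangent spaces\<close>

lemma chart_has_derivative:
  assumes c: "(W, \<phi>) \<in> A" and p: "p \<in> W" and h: "smooth_near A p h"
  shows "(h \<circ> inv_into W \<phi> has_derivative frechet_derivative (h \<circ> inv_into W \<phi>) (at (\<phi> p))) (at (\<phi> p))"
proof -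
  obtain V where V: "open V" "p \<in> V" "smooth_fun A V h" using h unfolding smooth_near_def by auto
  show ?thesis
    by (rule Cinf_on_has_derivative[OF smooth_funD[OF V(3) c]]) (use p V in auto)
qed

lemma chart_vec_eq:
  assumes c: "(W, \<phi>) \<in> A" and p: "p \<in> W"
    and h: "smooth_near A p h" "(h \<circ> inv_into W \<phi> has_derivative D) (at (\<phi> p))"
  shows "chart_vec A (W, \<phi>) p w h = D w"
  using frechet_derivative_at[OF h(2)] h(1) by (simp add: chart_vec_def)

lemma chart_vec_linear:
  assumes c: "(W, \<phi>) \<in> A" and p: "p \<in> W"
  shows "chart_vec A (W, \<phi>) p (a + b) = chart_vec A (W, \<phi>) p a + chart_vec A (W, \<phi>) p b"
    "chart_vec A (W, \<phi>) p (r *\<^sub>R a) = fscale r (chart_vec A (W, \<phi>) p a)"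
    "chart_vec A (W, \<phi>) p 0 = 0"
  using has_derivative_linear[OF chart_has_derivative[OF c p]]
  by (auto intro!: ext simp: chart_vec_def linear_add linear_scale linear_0)

lemma chart_vec_sum:
  assumes c: "(W, \<phi>) \<in> A" and p: "p \<in> W"
  shows "chart_vec A (W, \<phi>) p (\<Sum>i\<in>I. f i) = (\<Sum>i\<in>I. chart_vec A (W, \<phi>) p (f i))"
  by (induction I rule: infinite_finite_induct) (simp_all add: chart_vec_linear(1,3)[OF assms])

text \<open>The chain rule for the transition map. It frees the tangent space from the choice of
  chart and thereby makes it a vector space, although its definition is a union over all
  charts.\<close>

lemma chart_vec_change:
  assumes c: "(W, \<phi>) \<in> A" and c': "(W', \<phi>') \<in> A" and p: "p \<in> W" "p \<in> W'"
  shows "chart_vec A (W', \<phi>') p w =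
    chart_vec A (W, \<phi>) p (frechet_derivative (\<phi> \<circ> inv_into W' \<phi>') (at (\<phi>' p)) w)"
proof
  fix h
  show "chart_vec A (W', \<phi>') p w h =
    chart_vec A (W, \<phi>) p (frechet_derivative (\<phi> \<circ> inv_into W' \<phi>') (at (\<phi>' p)) w) h"
  proof (cases "smooth_near A p h")
    case True
    have t: "(\<phi> \<circ> inv_into W' \<phi>' has_derivative
        frechet_derivative (\<phi> \<circ> inv_into W' \<phi>') (at (\<phi>' p))) (at (\<phi>' p))"
      by (rule Cinf_on_has_derivative[OF transition_smooth[OF c c']]) (use p in auto)
    have "(h \<circ> inv_into W \<phi> has_derivative frechet_derivative (h \<circ> inv_into W \<phi>) (at (\<phi> p)))
        (at ((\<phi> \<circ> inv_into W' \<phi>') (\<phi>' p)))"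
      using chart_has_derivative[OF c p(1) True] chart(3)[OF c' p(2)] by simp
    from diff_chain_at[OF t this]
    have "(h \<circ> inv_into W' \<phi>' has_derivative frechet_derivative (h \<circ> inv_into W \<phi>) (at (\<phi> p)) \<circ>
        frechet_derivative (\<phi> \<circ> inv_into W' \<phi>') (at (\<phi>' p))) (at (\<phi>' p))"
    proof (rule has_derivative_transform_within_open)
      show "open (\<phi>' ` (W \<inter> W'))" using chart(4)[OF c' chart(1)[OF c]] .
    qed (use p chart(3)[OF c'] chart(3)[OF c] in auto)
    from chart_vec_eq[OF c' p(2) True this] True show ?thesis by (simp add: chart_vec_def)
  qed (simp add: chart_vec_def)
qed

lemma tspace_eq:
  assumes "(W, \<phi>) \<in> A" "p \<in> W"
  shows "tspace A p = range (chart_vec A (W, \<phi>) p)"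
proof
  show "tspace A p \<subseteq> range (chart_vec A (W, \<phi>) p)"
    unfolding tspace_def using chart_vec_change[OF assms(1) _ assms(2)] by auto
qed (use assms in \<open>auto simp: tspace_def intro!: bexI[of _ "(W, \<phi>)"]\<close>)

lemma tspace_add: "v \<in> tspace A p \<Longrightarrow> w \<in> tspace A p \<Longrightarrow> v + w \<in> tspace A p"
  by (rule ex_chart[of p]) (auto simp: tspace_eq chart_vec_linear[symmetric])

lemma tspace_fscale: "v \<in> tspace A p \<Longrightarrow> fscale a v \<in> tspace A p"
  by (rule ex_chart[of p]) (auto simp: tspace_eq chart_vec_linear[symmetric])

lemma tspace_0: "0 \<in> tspace A p"
  by (rule ex_chart[of p]) (auto simp: tspace_eq chart_vec_linear(3)[symmetric])

lemma tspace_diff: "v \<in> tspace A p \<Longrightarrow> w \<in> tspace A p \<Longrightarrow> v - w \<in> tspace A p"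
  using tspace_add[OF _ tspace_fscale[of w p "-1"], of v]
  by (simp add: fscale_def fun_eq_iff plus_fun_def fun_diff_def)

lemma tspace_sum: "(\<And>i. i \<in> I \<Longrightarrow> v i \<in> tspace A p) \<Longrightarrow> (\<Sum>i\<in>I. v i) \<in> tspace A p"
  by (induction I rule: infinite_finite_induct) (auto simp: tspace_0 intro!: tspace_add)

lemma tvec_not_smooth: "v \<in> tspace A p \<Longrightarrow> \<not> smooth_near A p h \<Longrightarrow> v h = 0"
  by (auto simp: tspace_def chart_vec_def split: prod.splits)

text \<open>Locality. Smoothness near \<open>p\<close> depends only on the germ, so the default
  value \<open>0\<close> on functions that are not smooth is taken for \<open>f\<close> and
  \<open>g\<close> alike.\<close>

lemma tvec_cong:
  assumes v: "v \<in> tspace A p" and V: "open V" "p \<in> V" and fg: "\<And>q. q \<in> V \<Longrightarrow> f q = g q"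
  shows "v f = v g"
proof -
  obtain W \<phi> where c: "(W, \<phi>) \<in> A" "p \<in> W" using ex_chart .
  obtain w where w: "v = chart_vec A (W, \<phi>) p w" using v tspace_eq[OF c] by auto
  have "smooth_near A p f \<longleftrightarrow> smooth_near A p g"
    using smooth_near_cong[OF V, of f g] smooth_near_cong[OF V, of g f] fg by auto
  moreover have "frechet_derivative (f \<circ> inv_into W \<phi>) (at (\<phi> p)) =
      frechet_derivative (g \<circ> inv_into W \<phi>) (at (\<phi> p))"
    by (rule frechet_derivative_cong_open[OF chart(4)[OF c(1) V(1)]])
      (use V c fg chart(3)[OF c(1)] in auto)
  ultimately show ?thesis by (simp add: w chart_vec_def)
qed

text \<open>The rule for \<open>exp\<close> is included for the sake of the conformal
  factor.\<close>

lemma tvec_derivation: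
  assumes v: "v \<in> tspace A p"
  shows "smooth_near A p f \<Longrightarrow> smooth_near A p g \<Longrightarrow> v (\<lambda>q. f q + g q) = v f + v g"
    and "smooth_near A p f \<Longrightarrow> smooth_near A p g \<Longrightarrow> v (\<lambda>q. f q * g q) = v f * g p + f p * v g"
    and "smooth_near A p f \<Longrightarrow> v (\<lambda>q. exp (f q)) = exp (f p) * v f"
    and "v (\<lambda>q. c) = 0"
proof -
  obtain W \<phi> where c: "(W, \<phi>) \<in> A" "p \<in> W" using ex_chart .
  obtain w where w: "v = chart_vec A (W, \<phi>) p w" using v tspace_eq[OF c] by auto
  note [simp] = chart(3)[OF c] chart_vec_def
  show "v (\<lambda>q. f q + g q) = v f + v g" if h: "smooth_near A p f" "smooth_near A p g"
    using chart_vec_eq[OF c smooth_near_add[OF h], of _ w] has_derivative_add[OF h[THEN chart_has_derivative[OF c]]] h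
    by (simp add: w o_def)
  show "v (\<lambda>q. f q * g q) = v f * g p + f p * v g" if h: "smooth_near A p f" "smooth_near A p g"
    using chart_vec_eq[OF c smooth_near_mult[OF h], of _ w] has_derivative_mult[OF h[THEN chart_has_derivative[OF c]]] h
    by (simp add: w o_def)
  show "v (\<lambda>q. exp (f q)) = exp (f p) * v f" if h: "smooth_near A p f"
  proof -
    have "smooth_near A p (\<lambda>q. exp (f q))"
      using h smooth_fun_exp unfolding smooth_near_def by blast
    from chart_vec_eq[OF c this, of _ w] has_derivative_exp[OF chart_has_derivative[OF c h]] h
    show ?thesis by (simp add: w o_def)
  qed
  show "v (\<lambda>q. c) = 0" using chart_vec_eq[OF c smooth_near_const, of c "\<lambda>_. 0" w] by (simp add: w o_def)
qed

lemma tvec_sum: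
  assumes v: "v \<in> tspace A p"
  shows "(\<And>i. i \<in> I \<Longrightarrow> smooth_near A p (f i)) \<Longrightarrow> v (\<lambda>q. \<Sum>i\<in>I. f i q) = (\<Sum>i\<in>I. v (f i))"
  by (induction I rule: infinite_finite_induct)
    (auto simp: tvec_derivation(4)[OF v] tvec_derivation(1)[OF v _ smooth_near_sum])

lemma vfieldsD: "X \<in> vfields A V \<Longrightarrow> p \<in> V \<Longrightarrow> X p \<in> tspace A p"
  "X \<in> vfields A V \<Longrightarrow> open W \<Longrightarrow> W \<subseteq> V \<Longrightarrow> smooth_fun A W h \<Longrightarrow> smooth_fun A W (\<lambda>p. X p h)"
  unfolding vfields_def by auto

lemma vfields_subset: "X \<in> vfields A V \<Longrightarrow> V' \<subseteq> V \<Longrightarrow> X \<in> vfields A V'"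
  unfolding vfields_def by auto

lemma vfields_add: "X \<in> vfields A V \<Longrightarrow> Y \<in> vfields A V \<Longrightarrow> (\<lambda>q. X q + Y q) \<in> vfields A V"
  unfolding vfields_def by (auto intro: tspace_add smooth_fun_add)

lemma vfields_fscale:
  "X \<in> vfields A V \<Longrightarrow> smooth_fun A V f \<Longrightarrow> (\<lambda>q. fscale (f q) (X q)) \<in> vfields A V"
  unfolding vfields_def by (auto intro: tspace_fscale smooth_fun_mult smooth_fun_subset)

lemma vfields_0: "(\<lambda>q. 0) \<in> vfields A V"
  unfolding vfields_def by (auto intro: tspace_0 smooth_fun_const)

lemma vfields_sum:
  "(\<And>i. i \<in> I \<Longrightarrow> X i \<in> vfields A V) \<Longrightarrow> (\<lambda>q. \<Sum>i\<in>I. X i q) \<in> vfields A V"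
  by (induction I rule: infinite_finite_induct) (auto simp: vfields_0 intro!: vfields_add)

lemma vfields_near_fun:
  assumes "X \<in> vfields A V" "open V" "p \<in> V" "smooth_near A p h"
  shows "smooth_near A p (\<lambda>q. X q h)"
proof -
  obtain V' where V': "open V'" "p \<in> V'" "smooth_fun A V' h"
    using assms(4) unfolding smooth_near_def by auto
  have "smooth_fun A (V \<inter> V') (\<lambda>q. X q h)"
    by (rule vfieldsD(2)[OF assms(1)]) (use assms V' smooth_fun_subset in auto)
  then show ?thesis using assms V' by (auto intro: smooth_nearI)
qed

lemma coord_smooth:
  assumes c: "(W, \<phi>) \<in> A"
  shows "smooth_fun A W (\<lambda>q. \<phi> q \<bullet> b)"
proof (rule smooth_fun_chartI[OF c chart(1)[OF c] order_refl])
  have o: "open (\<phi> ` W)" using chart(4)[OF c chart(1)[OF c]] by simp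
  have "Cinf_on (\<phi> \<circ> inv_into W \<phi>) (\<phi> ` W)" using transition_smooth[OF c c] by simp
  from Cinf_on_bounded_linear[OF bounded_linear_inner_left o this, of b]
  show "Cinf_on ((\<lambda>q. \<phi> q \<bullet> b) \<circ> inv_into W \<phi>) (\<phi> ` W)" by (simp add: o_def)
qed

text \<open>Coordinate functions are dual to coordinate vectors, so they read off the components of
  a tangent vector.\<close>

lemma chart_vec_coord:
  assumes c: "(W, \<phi>) \<in> A" and p: "p \<in> W"
  shows "chart_vec A (W, \<phi>) p w (\<lambda>q. \<phi> q \<bullet> b) = w \<bullet> b"
proof (rule chart_vec_eq[OF c p smooth_nearI[OF coord_smooth[OF c] chart(1)[OF c] p]])
  show "((\<lambda>q. \<phi> q \<bullet> b) \<circ> inv_into W \<phi> has_derivative (\<lambda>w. w \<bullet> b)) (at (\<phi> p))"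
  proof (rule has_derivative_transform_within_open)
    show "((\<lambda>x. x \<bullet> b) has_derivative (\<lambda>w. w \<bullet> b)) (at (\<phi> p))"
      by (rule bounded_linear_imp_has_derivative[OF bounded_linear_inner_left])
    show "open (\<phi> ` W)" using chart(4)[OF c chart(1)[OF c]] by simp
  qed (use p chart(3)[OF c] in auto)
qed

lemma chart_field:
  assumes c: "(W, \<phi>) \<in> A"
  shows "(\<lambda>p. chart_vec A (W, \<phi>) p w) \<in> vfields A W"
  unfolding vfields_def
proof (intro CollectI conjI ballI allI impI)
  fix p assume "p \<in> W"
  then show "chart_vec A (W, \<phi>) p w \<in> tspace A p" using tspace_eq[OF c] by auto
next
  fix V h assume V: "open V \<and> V \<subseteq> W \<and> smooth_fun A V h"
  then have VW: "\<phi> ` (V \<inter> W) = \<phi> ` V" by auto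
  show "smooth_fun A V (\<lambda>p. chart_vec A (W, \<phi>) p w h)"
  proof (rule smooth_fun_chartI[OF c])
    have "Cinf_on (h \<circ> inv_into W \<phi>) (\<phi> ` V)" using smooth_funD[of V h, OF _ c] V VW by auto
    from Cinf_on_derivative[OF this, of w]
    show "Cinf_on ((\<lambda>p. chart_vec A (W, \<phi>) p w h) \<circ> inv_into W \<phi>) (\<phi> ` V)"
    proof (rule Cinf_on_cong[rotated 2])
      show "open (\<phi> ` V)" using chart(4)[OF c, of V] V VW by auto
      fix y assume "y \<in> \<phi> ` V"
      then obtain q where "q \<in> V" "y = \<phi> q" by auto
      then show "frechet_derivative (h \<circ> inv_into W \<phi>) (at y) w =
          ((\<lambda>p. chart_vec A (W, \<phi>) p w h) \<circ> inv_into W \<phi>) y"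
        using V chart(3)[OF c] smooth_nearI[of V h q] by (auto simp: chart_vec_def)
    qed
  qed (use V in auto)
qed

text \<open>A frame together with functions \<open>f k\<close> whose differentials form the dual
  coframe. With coefficients of the form \<open>v (f k)\<close>, the components of a vector field
  are smooth by the very definition of \<open>vfields\<close>.\<close>

definition frame_on :: "'p set \<Rightarrow> (nat \<Rightarrow> 'p vfield) \<Rightarrow> (nat \<Rightarrow> 'p \<Rightarrow> real) \<Rightarrow> bool" where
  "frame_on W E f \<longleftrightarrow> open W \<and> (\<forall>k<DIM('b). E k \<in> vfields A W \<and> smooth_fun A W (f k)) \<and>
    (\<forall>q\<in>W. \<forall>v\<in>tspace A q. v = (\<Sum>k<DIM('b). fscale (v (f k)) (E k q)))"

lemma frame_onD:
  assumes "frame_on W E f"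
  shows "open W" "k < DIM('b) \<Longrightarrow> E k \<in> vfields A W" "k < DIM('b) \<Longrightarrow> smooth_fun A W (f k)"
    "q \<in> W \<Longrightarrow> v \<in> tspace A q \<Longrightarrow> v = (\<Sum>k<DIM('b). fscale (v (f k)) (E k q))"
  using assms unfolding frame_on_def by auto

lemma ex_frame: obtains W E f where "p \<in> W" "frame_on W E f"
proof -
  obtain W \<phi> where c: "(W, \<phi>) \<in> A" "p \<in> W" using ex_chart .
  obtain e where e: "bij_betw e {..<DIM('b)} (Basis :: 'b set)"
    using ex_bij_betw_nat_finite[of "Basis :: 'b set"] by (auto simp: lessThan_atLeast0)
  have rep: "v = (\<Sum>k<DIM('b). fscale (v (\<lambda>q. \<phi> q \<bullet> e k)) (chart_vec A (W, \<phi>) q (e k)))"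
    if q: "q \<in> W" and v: "v \<in> tspace A q" for q v
  proof -
    obtain w where w: "v = chart_vec A (W, \<phi>) q w" using v tspace_eq[OF c(1) q] by auto
    have "(\<Sum>k<DIM('b). (w \<bullet> e k) *\<^sub>R e k) = w"
      using sum.reindex_bij_betw[OF e, of "\<lambda>b. (w \<bullet> b) *\<^sub>R b"] by (simp add: euclidean_representation)
    then have "v = chart_vec A (W, \<phi>) q (\<Sum>k<DIM('b). (w \<bullet> e k) *\<^sub>R e k)" using w by simp
    also have "\<dots> = (\<Sum>k<DIM('b). fscale (w \<bullet> e k) (chart_vec A (W, \<phi>) q (e k)))"
      by (simp only: chart_vec_sum[OF c(1) q] chart_vec_linear[OF c(1) q])
    also have "\<dots> = (\<Sum>k<DIM('b). fscale (v (\<lambda>q. \<phi> q \<bullet> e k)) (chart_vec A (W, \<phi>) q (e k)))"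
      unfolding w chart_vec_coord[OF c(1) q] ..
    finally show ?thesis .
  qed
  have "frame_on W (\<lambda>k q. chart_vec A (W, \<phi>) q (e k)) (\<lambda>k q. \<phi> q \<bullet> e k)"
    unfolding frame_on_def
    using chart(1)[OF c(1)] chart_field[OF c(1)] coord_smooth[OF c(1)] rep by blast
  then show thesis using that c by blast
qed

text \<open>Constant coefficients in a local frame give the extension. One neighbourhood serves all
  vectors at \<open>p\<close>, so several of them can be extended over a common domain.\<close>

lemma extend_tvec:
  obtains W where "open W" "p \<in> W" "\<forall>v\<in>tspace A p. \<exists>X\<in>vfields A W. X p = v"
proof -
  obtain W E f where p: "p \<in> W" and F: "frame_on W E f" using ex_frame .
  show thesis
  proof (rule that[OF frame_onD(1)[OF F] p], rule ballI)
    fix v assume v: "v \<in> tspace A p"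
    have "(\<lambda>q. \<Sum>k<DIM('b). fscale (v (f k)) (E k q)) \<in> vfields A W"
      using frame_onD[OF F] by (intro vfields_sum vfields_fscale smooth_fun_const) auto
    then show "\<exists>X\<in>vfields A W. X p = v"
      using frame_onD(4)[OF F p v, symmetric] by (intro bexI)
  qed
qed

section \<open>Symmetric tensors and connections\<close>

lemma sym_forms2D:
  assumes b: "b \<in> sym_forms2 A U" and p: "p \<in> U"
  shows "v \<in> tspace A p \<Longrightarrow> w \<in> tspace A p \<Longrightarrow> w' \<in> tspace A p \<Longrightarrow> b p v (w + w') = b p v w + b p v w'"
    "v \<in> tspace A p \<Longrightarrow> w \<in> tspace A p \<Longrightarrow> b p v (fscale a w) = a * b p v w"
    "v \<in> tspace A p \<Longrightarrow> w \<in> tspace A p \<Longrightarrow> w' \<in> tspace A p \<Longrightarrow> b p (w + w') v = b p w v + b p w' v"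
    "v \<in> tspace A p \<Longrightarrow> w \<in> tspace A p \<Longrightarrow> b p (fscale a w) v = a * b p w v"
    "b p v w = b p w v"
proof -
  have l: "linear_on (tspace A p) (b p v)" if "v \<in> tspace A p" for v
    using b p that by (simp add: sym_forms2_def)
  have s: "b p v w = b p w v" for v w
  proof -
    have "\<forall>p v w. b p v w = b p w v" using b by (simp add: sym_forms2_def)
    then show ?thesis by blast
  qed
  show "b p v w = b p w v" by (rule s)
  show 1: "b p v (w + w') = b p v w + b p v w'"
    if "v \<in> tspace A p" "w \<in> tspace A p" "w' \<in> tspace A p"
    using l[OF that(1)] that unfolding linear_on_def by blast
  show 2: "b p v (fscale a w) = a * b p v w" if "v \<in> tspace A p" "w \<in> tspace A p"
    using l[OF that(1)] that unfolding linear_on_def by blast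
  show "v \<in> tspace A p \<Longrightarrow> w \<in> tspace A p \<Longrightarrow> w' \<in> tspace A p \<Longrightarrow> b p (w + w') v = b p w v + b p w' v"
    unfolding s[of _ v] by (rule 1)
  show "v \<in> tspace A p \<Longrightarrow> w \<in> tspace A p \<Longrightarrow> b p (fscale a w) v = a * b p w v"
    unfolding s[of _ v] by (rule 2)
qed

lemma sym_forms2_sum:
  assumes b: "b \<in> sym_forms2 A U" and p: "p \<in> U" and v: "v \<in> tspace A p"
    and u: "\<And>i. i \<in> I \<Longrightarrow> u i \<in> tspace A p"
  shows "b p v (\<Sum>i\<in>I. u i) = (\<Sum>i\<in>I. b p v (u i))"
    "b p (\<Sum>i\<in>I. u i) v = (\<Sum>i\<in>I. b p (u i) v)"
proof -
  have 0: "b p v 0 = 0" using sym_forms2D(2)[OF b p v tspace_0, of 0] by (simp add: fscale_def zero_fun_def)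
  show "b p v (\<Sum>i\<in>I. u i) = (\<Sum>i\<in>I. b p v (u i))"
    using u by (induction I rule: infinite_finite_induct)
      (auto simp: 0 sym_forms2D(1)[OF b p v] tspace_sum)
  then show "b p (\<Sum>i\<in>I. u i) v = (\<Sum>i\<in>I. b p (u i) v)"
    by (simp add: sym_forms2D(5)[OF b p, of _ v])
qed

lemma sym_forms2_sum_sum:
  assumes b: "b \<in> sym_forms2 A U" and p: "p \<in> U"
    and u: "\<And>i. i \<in> I \<Longrightarrow> u i \<in> tspace A p" and v: "\<And>j. j \<in> J \<Longrightarrow> v j \<in> tspace A p"
  shows "b p (\<Sum>i\<in>I. u i) (\<Sum>j\<in>J. v j) = (\<Sum>i\<in>I. \<Sum>j\<in>J. b p (u i) (v j))"
proof -
  have "b p (\<Sum>i\<in>I. u i) (\<Sum>j\<in>J. v j) = (\<Sum>i\<in>I. b p (u i) (\<Sum>j\<in>J. v j))"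
    using b p tspace_sum[OF v] u by (rule sym_forms2_sum(2))
  also have "\<dots> = (\<Sum>i\<in>I. \<Sum>j\<in>J. b p (u i) (v j))"
    using sym_forms2_sum(1)[OF b p u v] by (intro sum.cong refl)
  finally show ?thesis .
qed

lemma sym_forms2_smooth:
  assumes "b \<in> sym_forms2 A U" "open V" "V \<subseteq> U" "X \<in> vfields A V" "Y \<in> vfields A V"
  shows "smooth_fun A V (\<lambda>p. b p (X p) (Y p))"
  using assms by (simp add: sym_forms2_def)

lemma connectionD:
  assumes "is_connection A U D" "open V" "V \<subseteq> U" "X \<in> vfields A V" "Y \<in> vfields A V"
  shows "D X Y \<in> vfields A V"
    "X' \<in> vfields A V \<Longrightarrow> Y' \<in> vfields A V \<Longrightarrow> (\<And>q. q \<in> V \<Longrightarrow> X q = X' q) \<Longrightarrow>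
      (\<And>q. q \<in> V \<Longrightarrow> Y q = Y' q) \<Longrightarrow> p \<in> V \<Longrightarrow> D X Y p = D X' Y' p"
    "X' \<in> vfields A V \<Longrightarrow> p \<in> V \<Longrightarrow> D (\<lambda>q. X q + X' q) Y p = D X Y p + D X' Y p"
    "smooth_fun A V f \<Longrightarrow> p \<in> V \<Longrightarrow> D (\<lambda>q. fscale (f q) (X q)) Y p = fscale (f p) (D X Y p)"
    "Y' \<in> vfields A V \<Longrightarrow> p \<in> V \<Longrightarrow> D X (\<lambda>q. Y q + Y' q) p = D X Y p + D X Y' p"
    "smooth_fun A V f \<Longrightarrow> p \<in> V \<Longrightarrow>
      D X (\<lambda>q. fscale (f q) (Y q)) p = fscale (f p) (D X Y p) + fscale (X p f) (Y p)"
proof -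
  note c = mp[OF spec[OF assms(1)[unfolded is_connection_def]] conjI[OF assms(2,3)]]
  note c1 = conjunct1[OF c] and r1 = conjunct2[OF c]
  note c2 = conjunct1[OF r1] and r2 = conjunct2[OF r1]
  note c3 = conjunct1[OF r2] and r3 = conjunct2[OF r2]
  note c4 = conjunct1[OF r3] and r4 = conjunct2[OF r3]
  show "D X Y \<in> vfields A V" using c1 assms(4,5) by blast
  show "D X Y p = D X' Y' p" if "X' \<in> vfields A V" "Y' \<in> vfields A V" "\<And>q. q \<in> V \<Longrightarrow> X q = X' q"
    "\<And>q. q \<in> V \<Longrightarrow> Y q = Y' q" "p \<in> V"
    by (rule c2[rule_format]) (use that assms(4,5) in auto)
  show "X' \<in> vfields A V \<Longrightarrow> p \<in> V \<Longrightarrow> D (\<lambda>q. X q + X' q) Y p = D X Y p + D X' Y p"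
    by (rule c3[rule_format]) (use assms(4,5) in auto)
  show "smooth_fun A V f \<Longrightarrow> p \<in> V \<Longrightarrow> D (\<lambda>q. fscale (f q) (X q)) Y p = fscale (f p) (D X Y p)"
    by (rule c4[rule_format]) (use assms(4,5) in auto)
  show "Y' \<in> vfields A V \<Longrightarrow> p \<in> V \<Longrightarrow> D X (\<lambda>q. Y q + Y' q) p = D X Y p + D X Y' p"
    by (rule conjunct1[OF r4, rule_format]) (use assms(4,5) in auto)
  show "smooth_fun A V f \<Longrightarrow> p \<in> V \<Longrightarrow>
      D X (\<lambda>q. fscale (f q) (Y q)) p = fscale (f p) (D X Y p) + fscale (X p f) (Y p)"
    by (rule conjunct2[OF r4, rule_format]) (use assms(4,5) in auto)
qed

lemma connection_sum:
  assumes D: "is_connection A U D" and V: "open V" "V \<subseteq> U" "p \<in> V" and fin: "finite I"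
    and Y: "Y \<in> vfields A V" and E: "\<And>k. k \<in> I \<Longrightarrow> E k \<in> vfields A V"
    and c: "\<And>k. k \<in> I \<Longrightarrow> smooth_fun A V (c k)"
  shows "D (\<lambda>q. \<Sum>k\<in>I. fscale (c k q) (E k q)) Y p = (\<Sum>k\<in>I. fscale (c k p) (D (E k) Y p))"
    "D Y (\<lambda>q. \<Sum>k\<in>I. fscale (c k q) (E k q)) p =
      (\<Sum>k\<in>I. fscale (c k p) (D Y (E k) p) + fscale (Y p (c k)) (E k p))"
proof -
  \<comment> \<open>For the empty sum: the zero field is written as \<open>0\<close> times
    \<open>Y\<close>, so that homogeneity and the Leibniz rule give the value
    \<open>0\<close>.\<close>
  have s0: "(\<lambda>q. fscale 0 (Y q)) = (\<lambda>q. 0)" by (auto simp: fun_eq_iff)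
  have Z: "fscale 0 X = 0" for X :: "'p tvec" by (auto simp: fun_eq_iff)
  have c0: "Y p (\<lambda>q. 0) = 0" using tvec_derivation(4)[OF vfieldsD(1)[OF Y V(3)]] .
  have 0: "D (\<lambda>q. 0) Y p = 0" "D Y (\<lambda>q. 0) p = 0"
    using connectionD(4)[OF D V(1,2) Y Y smooth_fun_const[OF V(1), of 0] V(3)]
      connectionD(6)[OF D V(1,2) Y Y smooth_fun_const[OF V(1), of 0] V(3)] by (simp_all add: s0 Z c0)
  show "D (\<lambda>q. \<Sum>k\<in>I. fscale (c k q) (E k q)) Y p = (\<Sum>k\<in>I. fscale (c k p) (D (E k) Y p))"
    using fin E c
  proof (induction I)
    case (insert i I)
    have S: "(\<lambda>q. \<Sum>k\<in>I. fscale (c k q) (E k q)) \<in> vfields A V"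
      using insert by (intro vfields_sum vfields_fscale) auto
    have i: "E i \<in> vfields A V" "smooth_fun A V (c i)" using insert by auto
    show ?case
      unfolding sum.insert[OF insert(1,2)] connectionD(3)[OF D V(1,2) vfields_fscale[OF i] Y S V(3)]
        connectionD(4)[OF D V(1,2) i(1) Y i(2) V(3)]
      by (subst insert.IH) (use insert in auto)
  qed (simp add: 0)
  show "D Y (\<lambda>q. \<Sum>k\<in>I. fscale (c k q) (E k q)) p =
      (\<Sum>k\<in>I. fscale (c k p) (D Y (E k) p) + fscale (Y p (c k)) (E k p))"
    using fin E c
  proof (induction I)
    case (insert i I)
    have S: "(\<lambda>q. \<Sum>k\<in>I. fscale (c k q) (E k q)) \<in> vfields A V"
      using insert by (intro vfields_sum vfields_fscale) auto
    have i: "E i \<in> vfields A V" "smooth_fun A V (c i)" using insert by auto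
    show ?case
      unfolding sum.insert[OF insert(1,2)] connectionD(5)[OF D V(1,2) Y vfields_fscale[OF i] S V(3)]
        connectionD(6)[OF D V(1,2) Y i(1) i(2) V(3)]
      by (subst insert.IH) (use insert in auto)
  qed (simp add: 0)
qed

end

subsection \<open>Immersions and the ambient derivative\<close>

lemma push_add: "push B \<iota> p (v + w) = push B \<iota> p v + push B \<iota> p w"
  by (auto simp: push_def fun_eq_iff)

locale smooth_immersion = M: smooth_mfd A + Q: smooth_mfd B
  for A :: "('p::{t2_space, second_countable_topology}, 'b::euclidean_space) atlas"
    and B :: "('q::{t2_space, second_countable_topology}, 'e::euclidean_space) atlas" +
  fixes \<iota> :: "'p \<Rightarrow> 'q"
  assumes imm: "immersion A B \<iota>"
begin

lemma open_preimage: "open W \<Longrightarrow> open (\<iota> -` W)"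
  using imm by (simp add: immersion_def open_vimage continuous_on_eq_continuous_at)

lemma pullback_smooth: "open W \<Longrightarrow> smooth_fun B W h \<Longrightarrow> smooth_fun A (\<iota> -` W) (h \<circ> \<iota>)"
  using imm unfolding immersion_def by blast

lemma pullback_smooth_near: "smooth_near B (\<iota> p) h \<Longrightarrow> smooth_near A p (h \<circ> \<iota>)"
  unfolding smooth_near_def using pullback_smooth open_preimage by blast

text \<open>\<open>push\<close> is defined on functions, so a coordinate vector representing it has
  to be found. It is the derivative of the coordinate expression \<open>F\<close> of
  \<open>\<iota>\<close>, which is differentiable because each component is the pullback of a smooth
  coordinate function.\<close>

lemma push_tspace:
  assumes v: "v \<in> tspace A p"
  shows "push B \<iota> p v \<in> tspace B (\<iota> p)"
proof -
  obtain W \<phi> where c: "(W, \<phi>) \<in> A" "p \<in> W" using M.ex_chart .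
  obtain W' \<psi> where c': "(W', \<psi>) \<in> B" "\<iota> p \<in> W'" using Q.ex_chart .
  obtain w where w: "v = chart_vec A (W, \<phi>) p w" using v M.tspace_eq[OF c] by auto
  define F where "F = \<psi> \<circ> \<iota> \<circ> inv_into W \<phi>"
  have "F differentiable (at (\<phi> p))"
  proof (subst differentiable_componentwise_within, intro ballI)
    fix b :: 'e
    have "smooth_near A p ((\<lambda>r. \<psi> r \<bullet> b) \<circ> \<iota>)"
      using pullback_smooth_near[OF Q.smooth_nearI[OF Q.coord_smooth[OF c'(1)] Q.chart(1)[OF c'(1)] c'(2)]] .
    from M.chart_has_derivative[OF c this]
    show "(\<lambda>x. F x \<bullet> b) differentiable (at (\<phi> p))"
      unfolding differentiable_def F_def by (auto simp: o_def)
  qed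
  then obtain DF where DF: "(F has_derivative DF) (at (\<phi> p))" unfolding differentiable_def by blast
  have "push B \<iota> p v = chart_vec B (W', \<psi>) (\<iota> p) (DF w)"
  proof
    fix h
    show "push B \<iota> p v h = chart_vec B (W', \<psi>) (\<iota> p) (DF w) h"
    proof (cases "smooth_near B (\<iota> p) h")
      case True
      have "(h \<circ> inv_into W' \<psi> has_derivative frechet_derivative (h \<circ> inv_into W' \<psi>) (at (\<psi> (\<iota> p))))
          (at (F (\<phi> p)))"
        using Q.chart_has_derivative[OF c' True] M.chart(3)[OF c] by (simp add: F_def)
      from diff_chain_at[OF DF this]
      have "((h \<circ> \<iota>) \<circ> inv_into W \<phi> has_derivative
          frechet_derivative (h \<circ> inv_into W' \<psi>) (at (\<psi> (\<iota> p))) \<circ> DF) (at (\<phi> p))"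
      proof (rule has_derivative_transform_within_open)
        show "open (\<phi> ` (\<iota> -` W' \<inter> W))"
          using M.chart(4)[OF c(1) open_preimage[OF Q.chart(1)[OF c'(1)]]] .
      qed (use c c' M.chart(3)[OF c(1)] Q.chart(3)[OF c'(1)] in \<open>auto simp: F_def\<close>)
      from M.chart_vec_eq[OF c pullback_smooth_near[OF True] this] True
      show ?thesis by (simp add: push_def w chart_vec_def)
    qed (simp add: push_def chart_vec_def)
  qed
  then show ?thesis using Q.tspace_eq[OF c'] by auto
qed

lemma push_apply: "smooth_near B (\<iota> p) h \<Longrightarrow> push B \<iota> p v h = v (h \<circ> \<iota>)"
  by (simp add: push_def)

end

locale ambient = smooth_immersion A B \<iota>
  for A :: "('p::{t2_space, second_countable_topology}, 'b::euclidean_space) atlas"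
    and B :: "('q::{t2_space, second_countable_topology}, 'e::euclidean_space) atlas"
    and \<iota> :: "'p \<Rightarrow> 'q" +
  fixes G :: "'q form2" and N :: "'q vfield \<Rightarrow> 'q vfield \<Rightarrow> 'q vfield"
  assumes G: "G \<in> sym_forms2 B UNIV" and N: "levi_civita B G N"
begin

lemma conn: "is_connection B UNIV N" and tors: "torsion_free B UNIV N"
  and metr: "metric_connection B UNIV N G"
  using N unfolding levi_civita_def by auto

lemma metr_rule:
  assumes "open W" "X \<in> vfields B W" "Y \<in> vfields B W" "Z \<in> vfields B W" "r \<in> W"
  shows "X r (\<lambda>q. G q (Y q) (Z q)) = G r (N X Y r) (Z r) + G r (Y r) (N X Z r)"
  using metr assms by (simp add: metric_connection_def weyl_related_def cov_deriv2_def algebra_simps)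

text \<open>The ambient derivative along an immersion: the Leibniz rule in an ambient frame defines
  \<open>w X Y\<close>, which inherits torsion-freeness and metric compatibility from
  \<open>N\<close>. A single \<open>w\<close> is fixed before the fields are chosen, so that
  identities for different pairs of fields can be combined.\<close>

lemma ambient_derivs:
  obtains U w where "open U" "p \<in> U"
    "\<forall>V. open V \<and> V \<subseteq> U \<and> p \<in> V \<longrightarrow> (\<forall>X\<in>vfields A V. \<forall>Y\<in>vfields A V.
       ambient_deriv A B \<iota> N V X Y p (w X Y) \<and> w X Y \<in> tspace B (\<iota> p) \<and>
       push B \<iota> p (lie_bracket A X Y p) = w X Y - w Y X \<and>
       smooth_near A p (\<lambda>q. induced_metric A B \<iota> G q (X q) (Y q)) \<and>
       (\<forall>Z\<in>vfields A V. X p (\<lambda>q. induced_metric A B \<iota> G q (Y q) (Z q)) =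
         G (\<iota> p) (w X Y) (push B \<iota> p (Z p)) + G (\<iota> p) (push B \<iota> p (Y p)) (w X Z)))"
proof -
  obtain W E f where pW: "\<iota> p \<in> W" and F: "Q.frame_on W E f" using Q.ex_frame .
  note W = Q.frame_onD(1)[OF F] and E = Q.frame_onD(2)[OF F] and f = Q.frame_onD(3)[OF F]
  let ?m = "DIM('e)"
  define U where "U = \<iota> -` W"
  \<comment> \<open>Coefficients of \<open>X\<close> along \<open>\<iota>\<close>: the pushed vector
    applied to the ambient coordinate \<open>f k\<close> is \<open>X\<close> applied to its
    pullback.\<close>
  define c where "c X k = (\<lambda>q. X q (f k \<circ> \<iota>))" for X :: "'p vfield" and k
  \<comment> \<open>An ambient field that takes the value of the pushed vector \<open>X p\<close> at
    the point; the coefficients are frozen at \<open>p\<close>, so it is defined on all of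
    \<open>W\<close>.\<close>
  define Z where "Z X = (\<lambda>r. \<Sum>j<?m. fscale (c X j p) (E j r))" for X
  define w where "w X Y = (\<Sum>k<?m. fscale (X p (c Y k)) (E k (\<iota> p)) + fscale (c Y k p) (N (Z X) (E k) (\<iota> p)))"
    for X Y
  have U: "open U" "p \<in> U" unfolding U_def using open_preimage[OF W] pW by auto
  have Et: "E k (\<iota> q) \<in> tspace B (\<iota> q)" if "k < ?m" "q \<in> U" for k q
    using Q.vfieldsD(1)[OF E] that unfolding U_def by auto
  have nf: "smooth_near B r (f k)" if "k < ?m" "r \<in> W" for k r
    using Q.smooth_nearI[OF f W] that by auto
  have cs: "smooth_fun A V (c X k)" if "k < ?m" "open V" "V \<subseteq> U" "X \<in> vfields A V" for X V k
    unfolding c_def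
    using M.vfieldsD(2)[OF that(4,2)] M.smooth_fun_subset[OF pullback_smooth[OF W f[OF that(1)]]] that(3)
    by (auto simp: U_def)
  have cn: "smooth_near A p (c X k)" if "k < ?m" "open V" "V \<subseteq> U" "X \<in> vfields A V" "p \<in> V" for X V k
    using M.smooth_nearI[OF cs] that by auto
  have push: "push B \<iota> q v = (\<Sum>k<?m. fscale (v (f k \<circ> \<iota>)) (E k (\<iota> q)))"
    if "q \<in> U" "v \<in> tspace A q" for v q
  proof -
    have "\<iota> q \<in> W" using that unfolding U_def by auto
    then show ?thesis
      using Q.frame_onD(4)[OF F _ push_tspace[OF that(2)]] push_apply[OF nf, of _ q] by simp
  qed
  have pushX: "push B \<iota> q (X q) = (\<Sum>k<?m. fscale (c X k q) (E k (\<iota> q)))"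
    if "q \<in> V" "V \<subseteq> U" "X \<in> vfields A V" for X V q
    using push[of q "X q"] M.vfieldsD(1)[OF that(3,1)] that unfolding c_def by auto
  have Zf: "Z X \<in> vfields B W" for X
    unfolding Z_def using E by (intro Q.vfields_sum Q.vfields_fscale Q.smooth_fun_const W) auto
  have Zp: "Z X (\<iota> p) = push B \<iota> p (X p)" if "p \<in> V" "V \<subseteq> U" "X \<in> vfields A V" for X V
    using pushX[OF that] unfolding Z_def by simp
  have Nt: "N X' Y' (\<iota> p) \<in> tspace B (\<iota> p)" if "X' \<in> vfields B W" "Y' \<in> vfields B W" for X' Y'
    using Q.vfieldsD(1)[OF Q.connectionD(1)[OF conn W _ that]] pW by auto
  have wt: "w X Y \<in> tspace B (\<iota> p)" for X Y
    unfolding w_def using Nt[OF Zf E] Et U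
    by (intro Q.tspace_sum Q.tspace_add Q.tspace_fscale) auto
  have 1: "ambient_deriv A B \<iota> N V X Y p (w X Y)"
    if V: "open V" "V \<subseteq> U" "p \<in> V" "X \<in> vfields A V" "Y \<in> vfields A V" for V X Y
    unfolding ambient_deriv_def
  proof (intro exI conjI)
    show "open W" by (rule W)
    show "\<iota> ` V \<subseteq> W" using V unfolding U_def by auto
    show "\<forall>k<?m. smooth_fun A V (c Y k) \<and> E k \<in> vfields B W" using cs V E by auto
    show "\<forall>q\<in>V. push B \<iota> q (Y q) = (\<Sum>k<?m. fscale (c Y k q) (E k (\<iota> q)))" using pushX V by blast
    show "Z X \<in> vfields B W" by (rule Zf)
    show "Z X (\<iota> p) = push B \<iota> p (X p)" using Zp V by blast
    show "w X Y = (\<Sum>k<?m. fscale (X p (c Y k)) (E k (\<iota> p)) + fscale (c Y k p) (N (Z X) (E k) (\<iota> p)))"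
      by (rule w_def)
  qed
  have 2: "push B \<iota> p (lie_bracket A X Y p) = w X Y - w Y X"
    if V: "open V" "V \<subseteq> U" "p \<in> V" "X \<in> vfields A V" "Y \<in> vfields A V" for V X Y
  proof
    fix h
    show "push B \<iota> p (lie_bracket A X Y p) h = (w X Y - w Y X) h"
    proof (cases "smooth_near B (\<iota> p) h")
      case h: True
      obtain H where H: "open H" "\<iota> p \<in> H" "smooth_fun B H h" using h unfolding smooth_near_def by auto
      \<comment> \<open>The Hessian of \<open>h\<close> with respect to \<open>N\<close>, evaluated
        on the frame; torsion-freeness of \<open>N\<close> is its symmetry.\<close>
      define \<tau> where "\<tau> j k = E j (\<iota> p) (\<lambda>r. E k r h) - N (E j) (E k) (\<iota> p) h" for j k
      have \<tau>: "\<tau> j k = \<tau> k j" if "j < ?m" "k < ?m" for j k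
      proof -
        have "N (E j) (E k) (\<iota> p) - N (E k) (E j) (\<iota> p) = lie_bracket B (E j) (E k) (\<iota> p)"
          using tors W E[OF that(1)] E[OF that(2)] pW unfolding torsion_free_def by blast
        then have "(N (E j) (E k) (\<iota> p) - N (E k) (E j) (\<iota> p)) h = lie_bracket B (E j) (E k) (\<iota> p) h"
          by simp
        then show ?thesis using h by (simp add: \<tau>_def lie_bracket_def)
      qed
      have En: "smooth_near B (\<iota> p) (\<lambda>r. E k r h)" if "k < ?m" for k
        using Q.vfields_near_fun[OF E[OF that] W pW h] .
      \<comment> \<open>In the second derivative of the pullback of \<open>h\<close>, the terms that
        differentiate the coefficients of \<open>Y\<close> also occur in \<open>w X Y h\<close> and
        cancel. What remains is the Hessian on the two pushed vectors, which is symmetric, so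
        antisymmetrizing in \<open>X\<close> and \<open>Y\<close> leaves the bracket.\<close>
      have R: "X p (\<lambda>q. Y q (h \<circ> \<iota>)) - w X Y h = (\<Sum>k<?m. \<Sum>j<?m. c Y k p * c X j p * \<tau> j k)"
        if XY: "X \<in> vfields A V" "Y \<in> vfields A V" for X Y
      proof -
        have X: "X p \<in> tspace A p" using M.vfieldsD(1)[OF XY(1) V(3)] .
        have "X p (\<lambda>q. Y q (h \<circ> \<iota>)) = X p (\<lambda>q. \<Sum>k<?m. c Y k q * ((\<lambda>r. E k r h) \<circ> \<iota>) q)"
        proof (rule M.tvec_cong[OF X])
          show "open (V \<inter> \<iota> -` H)" "p \<in> V \<inter> \<iota> -` H" using V H open_preimage by auto
          fix q assume q: "q \<in> V \<inter> \<iota> -` H"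
          have "Y q (h \<circ> \<iota>) = push B \<iota> q (Y q) h"
            using push_apply[OF Q.smooth_nearI[OF H(3,1)], of q "Y q"] q by simp
          then show "Y q (h \<circ> \<iota>) = (\<Sum>k<?m. c Y k q * ((\<lambda>r. E k r h) \<circ> \<iota>) q)"
            using pushX[OF _ V(2) XY(2), of q] q by simp
        qed
        also have "\<dots> = (\<Sum>k<?m. X p (\<lambda>q. c Y k q * ((\<lambda>r. E k r h) \<circ> \<iota>) q))"
          by (rule M.tvec_sum[OF X])
            (use M.smooth_near_mult[OF cn[OF _ V(1,2) XY(2) V(3)] pullback_smooth_near[OF En]] in auto)
        also have "\<dots> = (\<Sum>k<?m. X p (c Y k) * E k (\<iota> p) h + c Y k p * X p ((\<lambda>r. E k r h) \<circ> \<iota>))"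
          by (intro sum.cong refl, subst M.tvec_derivation(2)[OF X cn[OF _ V(1,2) XY(2) V(3)] pullback_smooth_near[OF En]])
            auto
        also have "\<dots> = (\<Sum>k<?m. X p (c Y k) * E k (\<iota> p) h +
            c Y k p * (\<Sum>j<?m. c X j p * E j (\<iota> p) (\<lambda>r. E k r h)))"
        proof (intro sum.cong refl)
          fix k assume "k \<in> {..<?m}"
          then have "X p ((\<lambda>r. E k r h) \<circ> \<iota>) = push B \<iota> p (X p) (\<lambda>r. E k r h)"
            using push_apply[OF En] by auto
          then show "X p (c Y k) * E k (\<iota> p) h + c Y k p * X p ((\<lambda>r. E k r h) \<circ> \<iota>) =
            X p (c Y k) * E k (\<iota> p) h + c Y k p * (\<Sum>j<?m. c X j p * E j (\<iota> p) (\<lambda>r. E k r h))"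
            using pushX[OF V(3,2) XY(1)] by simp
        qed
        finally have L: "X p (\<lambda>q. Y q (h \<circ> \<iota>)) = \<dots>" .
        have "N (Z X) (E k) (\<iota> p) h = (\<Sum>j<?m. c X j p * N (E j) (E k) (\<iota> p) h)" if "k < ?m" for k
          unfolding Z_def
          by (subst Q.connection_sum(1)[OF conn W _ pW])
            (use E that Q.smooth_fun_const[OF W] in auto)
        then have "w X Y h = (\<Sum>k<?m. X p (c Y k) * E k (\<iota> p) h +
            c Y k p * (\<Sum>j<?m. c X j p * N (E j) (E k) (\<iota> p) h))"
          unfolding w_def by simp
        with L show ?thesis
          by (simp add: \<tau>_def sum_subtractf[symmetric] sum_distrib_left algebra_simps)
      qed
      have "(\<Sum>k<?m. \<Sum>j<?m. c Y k p * c X j p * \<tau> j k) = (\<Sum>k<?m. \<Sum>j<?m. c X k p * c Y j p * \<tau> j k)"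
        by (subst sum.swap) (auto intro!: sum.cong simp: \<tau>)
      then have "X p (\<lambda>q. Y q (h \<circ> \<iota>)) - Y p (\<lambda>q. X q (h \<circ> \<iota>)) = w X Y h - w Y X h"
        using R[OF V(4,5)] R[OF V(5,4)] by simp
      then show ?thesis
        using push_apply[OF h] pullback_smooth_near[OF h] by (simp add: lie_bracket_def)
    next
      case False
      \<comment> \<open>Both sides take the default value \<open>0\<close> at a function that is not
        smooth near the image point.\<close>
      then show ?thesis using Q.tvec_not_smooth[OF wt] by (simp add: push_def)
    qed
  qed
  let ?g = "\<lambda>j k r. G r (E j r) (E k r)"
  have gs: "smooth_fun B W (?g j k)" if "j < ?m" "k < ?m" for j k
    using Q.sym_forms2_smooth[OF G W _ E E] that by auto
  have gn: "smooth_near A p (?g j k \<circ> \<iota>)" if "j < ?m" "k < ?m" for j k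
    using pullback_smooth_near[OF Q.smooth_nearI[OF gs W pW]] that by auto
  \<comment> \<open>The induced metric in components: products of coefficient functions on the
    hypersurface with pullbacks of ambient functions, so that the Leibniz rule for
    \<open>X p\<close> applies to each term.\<close>
  have exp: "induced_metric A B \<iota> G q (Y q) (Z q) = (\<Sum>j<?m. \<Sum>k<?m. c Y j q * c Z k q * (?g j k \<circ> \<iota>) q)"
    if V: "V \<subseteq> U" "Y \<in> vfields A V" "Z \<in> vfields A V" "q \<in> V" for V Y Z q
  proof -
    have "induced_metric A B \<iota> G q (Y q) (Z q) =
      G (\<iota> q) (\<Sum>j<?m. fscale (c Y j q) (E j (\<iota> q))) (\<Sum>k<?m. fscale (c Z k q) (E k (\<iota> q)))"
      using V pushX[OF V(4,1)] M.vfieldsD(1) by (simp add: induced_metric_def)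
    also have "\<dots> = (\<Sum>j<?m. \<Sum>k<?m. c Y j q * c Z k q * (?g j k \<circ> \<iota>) q)"
    proof -
      have t: "E k (\<iota> q) \<in> tspace B (\<iota> q)" if "k < ?m" for k using Et that V by auto
      have "G (\<iota> q) (\<Sum>j<?m. fscale (c Y j q) (E j (\<iota> q))) (\<Sum>k<?m. fscale (c Z k q) (E k (\<iota> q))) =
        (\<Sum>j<?m. \<Sum>k<?m. G (\<iota> q) (fscale (c Y j q) (E j (\<iota> q))) (fscale (c Z k q) (E k (\<iota> q))))"
        by (rule Q.sym_forms2_sum_sum[OF G UNIV_I]) (use t in \<open>auto intro!: Q.tspace_fscale\<close>)
      then show ?thesis
        using t by (simp add: Q.sym_forms2D(2,4)[OF G UNIV_I] Q.tspace_fscale mult_ac)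
    qed
    finally show ?thesis .
  qed
  have tn: "smooth_near A p (\<lambda>q. c Y j q * c Z k q * (?g j k \<circ> \<iota>) q)"
    if "open V" "V \<subseteq> U" "p \<in> V" "Y \<in> vfields A V" "Z \<in> vfields A V" "j < ?m" "k < ?m" for V Y Z j k
    using that by (intro M.smooth_near_mult cn gn) auto
  have 4: "smooth_near A p (\<lambda>q. induced_metric A B \<iota> G q (Y q) (Z q))"
    if V: "open V" "V \<subseteq> U" "p \<in> V" "Y \<in> vfields A V" "Z \<in> vfields A V" for V Y Z
    by (rule M.smooth_near_cong[OF V(1,3) exp[OF V(2,4,5), symmetric]], assumption,
        intro M.smooth_near_sum tn[OF V]) auto
  have 3: "X p (\<lambda>q. induced_metric A B \<iota> G q (Y q) (Y' q)) =
         G (\<iota> p) (w X Y) (push B \<iota> p (Y' p)) + G (\<iota> p) (push B \<iota> p (Y p)) (w X Y')"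
    if V: "open V" "V \<subseteq> U" "p \<in> V" "X \<in> vfields A V" "Y \<in> vfields A V" "Y' \<in> vfields A V" for V X Y Y'
  proof -
    have X: "X p \<in> tspace A p" using M.vfieldsD(1)[OF V(4,3)] .
    let ?n = "\<lambda>k. N (Z X) (E k) (\<iota> p)" and ?e = "\<lambda>k. E k (\<iota> p)" and ?G = "G (\<iota> p)"
    \<comment> \<open>Differentiating a pulled-back function along \<open>X p\<close> is
      differentiating the ambient function along \<open>Z X\<close> at the image point, where
      compatibility of \<open>N\<close> with \<open>G\<close> is available.\<close>
    have dg: "X p (?g j k \<circ> \<iota>) = ?G (?n j) (?e k) + ?G (?e j) (?n k)" if "j < ?m" "k < ?m" for j k
    proof -
      have "X p (?g j k \<circ> \<iota>) = Z X (\<iota> p) (?g j k)"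
        using push_apply[OF Q.smooth_nearI[OF gs[OF that] W pW], of "X p"] Zp[OF V(3,2,4)] by simp
      then show ?thesis using metr_rule[OF W Zf E E pW] that by simp
    qed
    have "X p (\<lambda>q. induced_metric A B \<iota> G q (Y q) (Y' q)) =
      X p (\<lambda>q. \<Sum>j<?m. \<Sum>k<?m. c Y j q * c Y' k q * (?g j k \<circ> \<iota>) q)"
      by (rule M.tvec_cong[OF X V(1,3) exp[OF V(2,5,6)]])
    also have "\<dots> = (\<Sum>j<?m. \<Sum>k<?m. X p (\<lambda>q. c Y j q * c Y' k q * (?g j k \<circ> \<iota>) q))"
      using tn[OF V(1,2,3,5,6)] by (subst M.tvec_sum[OF X]; (intro M.smooth_near_sum sum.cong refl M.tvec_sum[OF X])?) auto
    also have "\<dots> = (\<Sum>j<?m. \<Sum>k<?m. (X p (c Y j) * c Y' k p + c Y j p * X p (c Y' k)) * ?G (?e j) (?e k)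
        + c Y j p * c Y' k p * (?G (?n j) (?e k) + ?G (?e j) (?n k)))"
    proof (intro sum.cong refl)
      fix j k assume jk: "j \<in> {..<?m}" "k \<in> {..<?m}"
      then have n: "smooth_near A p (c Y j)" "smooth_near A p (c Y' k)" "smooth_near A p (?g j k \<circ> \<iota>)"
        using cn gn V by auto
      show "X p (\<lambda>q. c Y j q * c Y' k q * (?g j k \<circ> \<iota>) q) =
        (X p (c Y j) * c Y' k p + c Y j p * X p (c Y' k)) * ?G (?e j) (?e k)
        + c Y j p * c Y' k p * (?G (?n j) (?e k) + ?G (?e j) (?n k))"
        using M.tvec_derivation(2)[OF X M.smooth_near_mult[OF n(1,2)] n(3)]
          M.tvec_derivation(2)[OF X n(1,2)] dg[of j k] jk by simp
    qed
    also have "\<dots> = ?G (w X Y) (push B \<iota> p (Y' p)) + ?G (push B \<iota> p (Y p)) (w X Y')"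
    proof -
      have t: "?n k \<in> tspace B (\<iota> p)" "?e k \<in> tspace B (\<iota> p)" if "k < ?m" for k
        using Nt[OF Zf E] Et U that by auto
      have "?G (w X Y) (push B \<iota> p (Y' p)) =
        (\<Sum>j<?m. \<Sum>k<?m. X p (c Y j) * c Y' k p * ?G (?e j) (?e k) + c Y j p * c Y' k p * ?G (?n j) (?e k))"
        unfolding pushX[OF V(3,2,6)] w_def
        by (subst Q.sym_forms2_sum_sum[OF G UNIV_I]; (intro sum.cong refl)?)
          (use t in \<open>auto intro!: Q.tspace_fscale Q.tspace_add
            simp: Q.sym_forms2D(1-4)[OF G UNIV_I] Q.tspace_fscale Q.tspace_add algebra_simps\<close>)
      moreover have "?G (push B \<iota> p (Y p)) (w X Y') =
        (\<Sum>j<?m. \<Sum>k<?m. c Y j p * X p (c Y' k) * ?G (?e j) (?e k) + c Y j p * c Y' k p * ?G (?e j) (?n k))"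
        unfolding pushX[OF V(3,2,5)] w_def
        by (subst Q.sym_forms2_sum_sum[OF G UNIV_I]; (intro sum.cong refl)?)
          (use t in \<open>auto intro!: Q.tspace_fscale Q.tspace_add
            simp: Q.sym_forms2D(1-4)[OF G UNIV_I] Q.tspace_fscale Q.tspace_add algebra_simps\<close>)
      ultimately show ?thesis by (simp add: sum.distrib algebra_simps)
    qed
    finally show ?thesis .
  qed
  show thesis
  proof (rule that[OF U, of w], intro allI impI ballI conjI)
  qed (rule 1 2 3 4 wt; auto)+
qed

end

section \<open>One-forms, tensoriality and representation of linear forms\<close>

context smooth_mfd
begin

lemma forms1D:
  assumes "\<omega> \<in> forms1 A U"
  shows "p \<in> U \<Longrightarrow> v \<in> tspace A p \<Longrightarrow> w \<in> tspace A p \<Longrightarrow> \<omega> p (v + w) = \<omega> p v + \<omega> p w"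
    "p \<in> U \<Longrightarrow> v \<in> tspace A p \<Longrightarrow> \<omega> p (fscale a v) = a * \<omega> p v"
    "p \<in> U \<Longrightarrow> v \<in> tspace A p \<Longrightarrow> w \<in> tspace A p \<Longrightarrow> \<omega> p (v - w) = \<omega> p v - \<omega> p w"
    "p \<notin> U \<or> v \<notin> tspace A p \<Longrightarrow> \<omega> p v = 0"
    "open V \<Longrightarrow> V \<subseteq> U \<Longrightarrow> X \<in> vfields A V \<Longrightarrow> smooth_fun A V (\<lambda>p. \<omega> p (X p))"
    "p \<in> U \<Longrightarrow> \<omega> p 0 = 0"
proof -
  have l: "linear_on (tspace A p) (\<omega> p)" if "p \<in> U" for p
    using assms that by (simp add: forms1_def)
  show 1: "p \<in> U \<Longrightarrow> v \<in> tspace A p \<Longrightarrow> w \<in> tspace A p \<Longrightarrow> \<omega> p (v + w) = \<omega> p v + \<omega> p w" for v w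
    using l[of p] unfolding linear_on_def by blast
  show 2: "p \<in> U \<Longrightarrow> v \<in> tspace A p \<Longrightarrow> \<omega> p (fscale a v) = a * \<omega> p v" for a v
    using l[of p] unfolding linear_on_def by blast
  show "p \<in> U \<Longrightarrow> v \<in> tspace A p \<Longrightarrow> w \<in> tspace A p \<Longrightarrow> \<omega> p (v - w) = \<omega> p v - \<omega> p w"
    using 1[of "v - w" w] tspace_diff by simp
  show "p \<notin> U \<or> v \<notin> tspace A p \<Longrightarrow> \<omega> p v = 0" using assms by (auto simp: forms1_def)
  show "open V \<Longrightarrow> V \<subseteq> U \<Longrightarrow> X \<in> vfields A V \<Longrightarrow> smooth_fun A V (\<lambda>p. \<omega> p (X p))"
    using assms by (simp add: forms1_def)
  show "p \<in> U \<Longrightarrow> \<omega> p 0 = 0" using 1[of 0 0] tspace_0 by simp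
qed

text \<open>In a frame, a connection is its values on frame fields plus derivatives of the
  coefficients of \<open>Y\<close>. The latter do not involve the connection and cancel in the
  difference, leaving only the components of \<open>X\<close> and \<open>Y\<close> at
  \<open>p\<close>. The two pairs may live on different domains; both are restricted to their
  intersection with the frame domain.\<close>

lemma connection_diff_tensorial:
  assumes D1: "is_connection A U D1" and D2: "is_connection A U D2"
    and V: "open V" "V \<subseteq> U" "p \<in> V" "X \<in> vfields A V" "Y \<in> vfields A V"
    and V': "open V'" "V' \<subseteq> U" "p \<in> V'" "X' \<in> vfields A V'" "Y' \<in> vfields A V'"
    and eq: "X p = X' p" "Y p = Y' p"
  shows "D1 X Y p - D2 X Y p = D1 X' Y' p - D2 X' Y' p"
proof -
  obtain W E f where pW: "p \<in> W" and F: "frame_on W E f" using ex_frame .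
  define Q where "Q = V \<inter> V' \<inter> W"
  have Q: "open Q" "Q \<subseteq> U" "p \<in> Q" "Q \<subseteq> W"
    using V V' pW frame_onD(1)[OF F] by (auto simp: Q_def)
  have E: "E k \<in> vfields A Q" if "k < DIM('b)" for k
    using vfields_subset[OF frame_onD(2)[OF F that] Q(4)] .
  have f: "smooth_fun A Q (f k)" if "k < DIM('b)" for k
    using smooth_fun_subset[OF frame_onD(3)[OF F that] Q(4)] .
  let ?I = "{..<DIM('b)}"
  have expand: "D1 X Y p - D2 X Y p =
      (\<Sum>k\<in>?I. fscale (X p (f k)) (\<Sum>l\<in>?I. fscale (Y p (f l)) (D1 (E k) (E l) p - D2 (E k) (E l) p)))"
    if X: "X \<in> vfields A Q" and Y: "Y \<in> vfields A Q" for X Y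
  proof -
    have c: "smooth_fun A Q (\<lambda>q. X q (f k))" "smooth_fun A Q (\<lambda>q. Y q (f k))" if "k \<in> ?I" for k
      using vfieldsD(2)[OF X Q(1) order_refl f] vfieldsD(2)[OF Y Q(1) order_refl f] that by auto
    have E': "E k \<in> vfields A Q" if "k \<in> ?I" for k using E that by auto
    have rep: "Z q = (\<Sum>k\<in>?I. fscale (Z q (f k)) (E k q))" if "Z \<in> vfields A Q" "q \<in> Q" for Z q
      using frame_onD(4)[OF F _ vfieldsD(1)[OF that]] that Q(4) by auto
    have vf: "(\<lambda>q. \<Sum>k\<in>?I. fscale (Z q (f k)) (E k q)) \<in> vfields A Q" if "Z \<in> vfields A Q" for Z
      using vfieldsD(2)[OF that Q(1) order_refl f] E by (intro vfields_sum vfields_fscale) auto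
    have D: "D X Y p = (\<Sum>k\<in>?I. fscale (X p (f k)) (\<Sum>l\<in>?I. fscale (Y p (f l)) (D (E k) (E l) p) +
        fscale (E k p (\<lambda>q. Y q (f l))) (E l p)))" if D: "is_connection A U D" for D
    proof -
      have "D X Y p = D (\<lambda>q. \<Sum>k\<in>?I. fscale (X q (f k)) (E k q)) (\<lambda>q. \<Sum>k\<in>?I. fscale (Y q (f k)) (E k q)) p"
        by (rule connectionD(2)[OF D Q(1,2) X Y vf[OF X] vf[OF Y] rep[OF X] rep[OF Y] Q(3)])
      also have "\<dots> = (\<Sum>k\<in>?I. fscale (X p (f k)) (D (E k) (\<lambda>q. \<Sum>k\<in>?I. fscale (Y q (f k)) (E k q)) p))"
        by (rule connection_sum(1)[OF D Q(1-3) finite_lessThan vf[OF Y] E' c(1)])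
      also have "\<dots> = (\<Sum>k\<in>?I. fscale (X p (f k)) (\<Sum>l\<in>?I. fscale (Y p (f l)) (D (E k) (E l) p) +
        fscale (E k p (\<lambda>q. Y q (f l))) (E l p)))"
        by (intro sum.cong refl arg_cong[where f="fscale _"]
            connection_sum(2)[OF D Q(1-3) finite_lessThan E' E' c(2)])
      finally show ?thesis .
    qed
    show ?thesis
      unfolding D[OF D1] D[OF D2]
      by (rule ext) (simp add: sum_subtractf[symmetric] right_diff_distrib[symmetric] sum.distrib)
  qed
  have "Z \<in> vfields A Q" if "Z \<in> vfields A V \<or> Z \<in> vfields A V'" for Z
    using that vfields_subset[of Z V Q] vfields_subset[of Z V' Q] by (auto simp: Q_def)
  then show ?thesis using expand[of X Y] expand[of X' Y'] V V' eq by simp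
qed

text \<open>In coordinates, \<open>b\<close> becomes an endomorphism of the finite-dimensional model
  space. Nondegeneracy makes it injective, hence surjective, so every linear form is hit.\<close>

lemma nondegenerate_representation:
  assumes lin: "\<And>v w. v \<in> tspace A p \<Longrightarrow> w \<in> tspace A p \<Longrightarrow> l (v + w) = l v + (l w :: real)"
      "\<And>a v. v \<in> tspace A p \<Longrightarrow> l (fscale a v) = a * l v"
    and add: "\<And>u v w. u \<in> tspace A p \<Longrightarrow> v \<in> tspace A p \<Longrightarrow> w \<in> tspace A p \<Longrightarrow> b (u + v) w = b u w + (b v w :: real)"
    and scale: "\<And>a u w. u \<in> tspace A p \<Longrightarrow> w \<in> tspace A p \<Longrightarrow> b (fscale a u) w = a * b u w"
    and sym: "\<And>u w. u \<in> tspace A p \<Longrightarrow> w \<in> tspace A p \<Longrightarrow> b u w = b w u"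
    and nondeg: "\<And>u. u \<in> tspace A p \<Longrightarrow> (\<And>w. w \<in> tspace A p \<Longrightarrow> b u w = 0) \<Longrightarrow> u = 0"
  shows "\<exists>u\<in>tspace A p. \<forall>w\<in>tspace A p. l w = b u w"
proof -
  obtain W \<phi> where c: "(W, \<phi>) \<in> A" "p \<in> W" using ex_chart .
  let ?E = "chart_vec A (W, \<phi>) p"
  have t: "?E x \<in> tspace A p" for x using tspace_eq[OF c] by auto
  note E = chart_vec_linear[OF c]
  \<comment> \<open>The vector that represents \<open>b\<close> with first argument \<open>x\<close>
    through the inner product of the model space.\<close>
  define L where "L x = (\<Sum>e\<in>Basis. b (?E x) (?E e) *\<^sub>R e)" for x
  have L: "L x \<bullet> y = b (?E x) (?E y)" for x y
  proof -
    have "linear (\<lambda>y. b (?E x) (?E y))"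
      by (rule linearI) (simp_all add: E t sym[OF t[of x]] add scale tspace_add tspace_fscale)
    then have "b (?E x) (?E (\<Sum>e\<in>Basis. (y \<bullet> e) *\<^sub>R e)) = (\<Sum>e\<in>Basis. (y \<bullet> e) *\<^sub>R b (?E x) (?E e))"
      by (simp only: linear_sum[of "\<lambda>y. b (?E x) (?E y)"] linear_scale[of "\<lambda>y. b (?E x) (?E y)"])
    then have "b (?E x) (?E y) = (\<Sum>e\<in>Basis. (y \<bullet> e) *\<^sub>R b (?E x) (?E e))"
      by (simp only: euclidean_representation)
    then show ?thesis by (simp add: L_def inner_sum_left inner_commute[of y] mult.commute)
  qed
  have "linear L"
    by (rule linearI) (simp_all add: L_def E t add scale sum.distrib scaleR_sum_right algebra_simps)
  moreover have "inj L"
  proof (subst linear_injective_0[OF \<open>linear L\<close>], intro allI impI)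
    fix x assume "L x = 0"
    then have "b (?E x) w = 0" if "w \<in> tspace A p" for w
      using that L[of x] tspace_eq[OF c] by auto
    then have "?E x = 0" using nondeg t by blast
    then have "x \<bullet> e = 0" for e using chart_vec_coord[OF c, of x e] by simp
    then show "x = 0" by (metis inner_eq_zero_iff)
  qed
  ultimately have "surj L" by (rule linear_inj_imp_surj)
  then obtain x where x: "L x = (\<Sum>e\<in>Basis. l (?E e) *\<^sub>R e)" by (metis surjD)
  have "l (?E y) = b (?E x) (?E y)" for y
  proof -
    have "linear (\<lambda>y. l (?E y))"
      by (rule linearI) (simp_all add: E t lin)
    then have "l (?E (\<Sum>e\<in>Basis. (y \<bullet> e) *\<^sub>R e)) = (\<Sum>e\<in>Basis. (y \<bullet> e) *\<^sub>R l (?E e))"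
      by (simp only: linear_sum[of "\<lambda>y. l (?E y)"] linear_scale[of "\<lambda>y. l (?E y)"])
    then have "l (?E y) = (\<Sum>e\<in>Basis. (y \<bullet> e) *\<^sub>R l (?E e))"
      by (simp only: euclidean_representation)
    then show ?thesis
      unfolding L[symmetric] x by (simp add: inner_sum_left inner_commute[of y] mult.commute)
  qed
  then show ?thesis using t tspace_eq[OF c] by auto
qed

end

subsection \<open>Horizontality of the Weyl form\<close>

context ambient
begin

abbreviation "g0 \<equiv> induced_metric A B \<iota> G"

lemma induced_metric_bilinear:
  "g0 p v w = g0 p w v"
  "v \<in> tspace A p \<Longrightarrow> w \<in> tspace A p \<Longrightarrow> u \<in> tspace A p \<Longrightarrow> g0 p (v + w) u = g0 p v u + g0 p w u"
  "v \<in> tspace A p \<Longrightarrow> u \<in> tspace A p \<Longrightarrow> g0 p (fscale a v) u = a * g0 p v u"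
proof -
  have s: "push B \<iota> p (fscale a v) = fscale a (push B \<iota> p v)" for a v
    by (auto simp: push_def fun_eq_iff)
  show "g0 p v w = g0 p w v" by (simp add: induced_metric_def Q.sym_forms2D(5)[OF G, of _ "push B \<iota> p v"])
  show "v \<in> tspace A p \<Longrightarrow> w \<in> tspace A p \<Longrightarrow> u \<in> tspace A p \<Longrightarrow> g0 p (v + w) u = g0 p v u + g0 p w u"
    by (simp add: induced_metric_def push_add M.tspace_add Q.sym_forms2D(3)[OF G] push_tspace)
  show "v \<in> tspace A p \<Longrightarrow> u \<in> tspace A p \<Longrightarrow> g0 p (fscale a v) u = a * g0 p v u"
    by (simp add: induced_metric_def s M.tspace_fscale Q.sym_forms2D(4)[OF G] push_tspace)
qed

text \<open>For total geodesicity only \<open>G(\<nabla>\<^sub>Y Y, X) = 0\<close> at \<open>p\<close> enters, so \<open>X\<close> need not be radical near \<open>p\<close>.\<close>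
lemma lie_derivative_rad:
  assumes tg: "totally_geodesic A B \<iota> G N" and V: "open V" "p \<in> V"
    and X: "X \<in> vfields A V" and Y: "Y \<in> vfields A V"
    and r: "X p \<in> rad A g0 p" and l: "lie_bracket A X Y p \<in> tspace A p"
  shows "X p (\<lambda>q. g0 q (Y q) (Y q)) - 2 * g0 p (lie_bracket A X Y p) (Y p)
      - 2 * Y p (\<lambda>q. g0 q (X q) (Y q)) = 0"
    and "smooth_near A p (\<lambda>q. g0 q (Y q) (Y q))" "smooth_near A p (\<lambda>q. g0 q (X q) (Y q))"
proof -
  obtain U w where U: "open U" "p \<in> U"
    and a: "\<forall>V. open V \<and> V \<subseteq> U \<and> p \<in> V \<longrightarrow> (\<forall>X\<in>vfields A V. \<forall>Y\<in>vfields A V.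
       ambient_deriv A B \<iota> N V X Y p (w X Y) \<and> w X Y \<in> tspace B (\<iota> p) \<and>
       push B \<iota> p (lie_bracket A X Y p) = w X Y - w Y X \<and>
       smooth_near A p (\<lambda>q. g0 q (X q) (Y q)) \<and>
       (\<forall>Z\<in>vfields A V. X p (\<lambda>q. g0 q (Y q) (Z q)) =
         G (\<iota> p) (w X Y) (push B \<iota> p (Z p)) + G (\<iota> p) (push B \<iota> p (Y p)) (w X Z)))"
    using ambient_derivs[of p] .
  let ?V = "V \<inter> U"
  have O: "open ?V" "?V \<subseteq> U" "p \<in> ?V" using V U by auto
  have XY: "X \<in> vfields A ?V" "Y \<in> vfields A ?V"
    using X Y M.vfields_subset[of _ V ?V] by auto
  have O': "open ?V \<and> ?V \<subseteq> U \<and> p \<in> ?V" using O by simp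
  note a = mp[OF spec[OF a] O']
  note aXY = bspec[OF bspec[OF a XY(1)] XY(2)] and aYX = bspec[OF bspec[OF a XY(2)] XY(1)]
    and aYY = bspec[OF bspec[OF a XY(2)] XY(2)]
  show "smooth_near A p (\<lambda>q. g0 q (Y q) (Y q))" "smooth_near A p (\<lambda>q. g0 q (X q) (Y q))"
    using aYY aXY by simp_all
  have t: "w X Y \<in> tspace B (\<iota> p)" "w Y X \<in> tspace B (\<iota> p)"
    "push B \<iota> p (Y p) \<in> tspace B (\<iota> p)" "Y p \<in> tspace A p"
    using aXY aYX push_tspace M.vfieldsD(1)[OF Y V(2)] by simp_all
  have c: "X p (\<lambda>q. g0 q (Y q) (Y q)) =
      G (\<iota> p) (w X Y) (push B \<iota> p (Y p)) + G (\<iota> p) (push B \<iota> p (Y p)) (w X Y)"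
    "Y p (\<lambda>q. g0 q (X q) (Y q)) =
      G (\<iota> p) (w Y X) (push B \<iota> p (Y p)) + G (\<iota> p) (push B \<iota> p (X p)) (w Y Y)"
    using aXY aYX XY by simp_all
  have ad: "ambient_deriv A B \<iota> N ?V Y Y p (w Y Y)"
    and b: "push B \<iota> p (lie_bracket A X Y p) = w X Y - w Y X" using aYY aXY by simp_all
  have "G (\<iota> p) (w Y Y) (push B \<iota> p (X p)) = 0"
    using tg O(1,3) XY(2) ad r unfolding totally_geodesic_def by blast
  then have z: "G (\<iota> p) (push B \<iota> p (X p)) (w Y Y) = 0"
    using Q.sym_forms2D(5)[OF G UNIV_I] by metis
  have "g0 p (lie_bracket A X Y p) (Y p) = G (\<iota> p) (w X Y - w Y X) (push B \<iota> p (Y p))"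
    using l t by (simp add: induced_metric_def b)
  also have "\<dots> = G (\<iota> p) (w X Y) (push B \<iota> p (Y p)) - G (\<iota> p) (w Y X) (push B \<iota> p (Y p))"
    using Q.sym_forms2D(3)[OF G UNIV_I t(3), of "w X Y - w Y X" "w Y X"] t Q.tspace_diff by simp
  finally show "X p (\<lambda>q. g0 q (Y q) (Y q)) - 2 * g0 p (lie_bracket A X Y p) (Y p)
      - 2 * Y p (\<lambda>q. g0 q (X q) (Y q)) = 0"
    using c z
      Q.sym_forms2D(5)[OF G UNIV_I, of "\<iota> p" "w X Y" "push B \<iota> p (Y p)"] by simp
qed

lemma weyl_form_rad:
  assumes tg: "totally_geodesic A B \<iota> G N"
    and f: "smooth_fun A UNIV f" and fr: "\<And>v. v \<in> rad A g0 p \<Longrightarrow> v f = 0"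
    and g: "g = (\<lambda>p v w. exp (- 2 * f p) * g0 p v w)"
    and D: "is_connection A UNIV D" "torsion_free A UNIV D" and W: "weyl_related A UNIV D g \<theta>"
    and v: "v \<in> rad A g0 p" and u: "u \<in> tspace A p" "g p u u \<noteq> 0"
  shows "\<theta> p v = 0"
proof -
  obtain V where V: "open V" "p \<in> V" and ex: "\<forall>v\<in>tspace A p. \<exists>X\<in>vfields A V. X p = v"
    using M.extend_tvec[of p] .
  have vt: "v \<in> tspace A p" using v by (simp add: rad_def)
  obtain X Y where X: "X \<in> vfields A V" "X p = v" and Y: "Y \<in> vfields A V" "Y p = u"
    using ex vt u by metis
  let ?l = "lie_bracket A X Y p"
  have Dt: "D X' Y' p \<in> tspace A p" if "X' \<in> vfields A V" "Y' \<in> vfields A V" for X' Y'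
    using M.vfieldsD(1)[OF M.connectionD(1)[OF D(1) V(1) _ that] V(2)] by simp
  have tor: "D X Y p - D Y X p = ?l"
    using D(2) V X Y unfolding torsion_free_def by blast
  then have lt: "?l \<in> tspace A p" using M.tspace_diff[OF Dt Dt] X Y by metis
  have gr: "g p v w = 0" if "w \<in> tspace A p" for w using v that by (simp add: rad_def g)
  have gs: "g p a b = g p b a" for a b by (simp add: g induced_metric_bilinear(1)[of p a])
  have "D X Y p = ?l + D Y X p" by (simp add: tor[symmetric])
  then have gD: "g p (D X Y p) u = g p ?l u + g p (D Y X p) u"
    using induced_metric_bilinear(2)[OF lt Dt[OF Y(1) X(1)] u(1)] by (simp add: g algebra_simps)
  have W': "cov_deriv2 D g X' Y' Z' p = - 2 * \<theta> p (X' p) * g p (Y' p) (Z' p)"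
    if "X' \<in> vfields A V" "Y' \<in> vfields A V" "Z' \<in> vfields A V" for X' Y' Z'
    using W V that unfolding weyl_related_def by blast
  have 1: "X p (\<lambda>q. g q (Y q) (Y q)) - 2 * g p (D X Y p) u = - 2 * \<theta> p v * g p u u"
    using W'[OF X(1) Y(1) Y(1)] X Y gs[of u "D X Y p"] by (simp add: cov_deriv2_def)
  \<comment> \<open>Since \<open>X p\<close> is radical, the right-hand side of the Weyl equation
    vanishes here, and so does the term pairing \<open>X\<close> with the derivative of
    \<open>Y\<close>.\<close>
  have 2: "Y p (\<lambda>q. g q (X q) (Y q)) - g p (D Y X p) u = 0"
    using W'[OF Y(1) X(1) Y(1)] X Y gr u Dt by (simp add: cov_deriv2_def)
  note L = lie_derivative_rad[OF tg V X(1) Y(1) _ lt, unfolded X(2), OF v]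
  have nf: "smooth_near A p f" using M.smooth_nearI[OF f] by simp
  have nf2: "smooth_near A p (\<lambda>q. - 2 * f q)" using M.smooth_near_mult[OF M.smooth_near_const nf] .
  have ne: "smooth_near A p (\<lambda>q. exp (- 2 * f q))"
    by (rule M.smooth_nearI[OF M.smooth_fun_exp[OF _ M.smooth_fun_mult[OF _ M.smooth_fun_const f]]]) auto
  \<comment> \<open>Metrics of the class have \<open>f\<close> constant in radical directions, so
    \<open>v\<close> does not see the conformal factor.\<close>
  have "v (\<lambda>q. exp (- 2 * f q)) = 0"
    using M.tvec_derivation(3)[OF vt nf2] M.tvec_derivation(2)[OF vt M.smooth_near_const nf, of "-2"]
      M.tvec_derivation(4)[OF vt, of "-2"] fr[OF v] by simp
  then have 3: "X p (\<lambda>q. g q (Y q) (Y q)) = exp (- 2 * f p) * X p (\<lambda>q. g0 q (Y q) (Y q))"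
    unfolding g using M.tvec_derivation(2)[OF vt ne L(2)] X by simp
  \<comment> \<open>\<open>f\<close> may vary along \<open>Y\<close>, but the derivative of the
    factor is multiplied by \<open>g0\<close> on \<open>X p\<close> and \<open>Y p\<close>, which is
    \<open>0\<close> because \<open>X p\<close> is radical.\<close>
  have 4: "Y p (\<lambda>q. g q (X q) (Y q)) = exp (- 2 * f p) * Y p (\<lambda>q. g0 q (X q) (Y q))"
    unfolding g using M.tvec_derivation(2)[OF u(1) ne L(3)] X Y v u by (simp add: rad_def)
  have "- 2 * \<theta> p v * g p u u = X p (\<lambda>q. g q (Y q) (Y q)) - 2 * g p ?l u - 2 * Y p (\<lambda>q. g q (X q) (Y q))"
    using 1 2 gD by simp
  also have "\<dots> = exp (- 2 * f p) * (X p (\<lambda>q. g0 q (Y q) (Y q)) - 2 * g0 p ?l (Y p)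
      - 2 * Y p (\<lambda>q. g0 q (X q) (Y q)))"
    unfolding 3 4 using Y(2) by (simp add: g algebra_simps)
  also have "\<dots> = 0" using L(1) X(2) by simp
  finally show ?thesis using u by simp
qed

end

subsection \<open>The difference tensor of a Weyl connection and a metric connection\<close>

text \<open>The situation over \<open>U\<close> for one metric \<open>g\<close> of the class.
  Radical, horizontal forms and screen projection are formed from \<open>g\<close> here; they depend
  on the metric only through its radical and therefore agree with those of
  \<open>g0\<close>.\<close>

locale weyl_local = smooth_mfd A
  for A :: "('p::{t2_space, second_countable_topology}, 'b::euclidean_space) atlas" +
  fixes U :: "'p set" and g :: "'p form2" and \<S> :: "'p \<Rightarrow> 'p tvec set"
    and \<xi> :: "'p vfield" and \<eta> \<theta> :: "'p form1" and D Dg :: "'p vfield \<Rightarrow> 'p vfield \<Rightarrow> 'p vfield"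
  assumes U: "open U"
    and g_sym: "\<And>p v w. g p v w = g p w v"
    and g_add: "\<And>p v w u. v \<in> tspace A p \<Longrightarrow> w \<in> tspace A p \<Longrightarrow> u \<in> tspace A p \<Longrightarrow>
      g p (v + w) u = g p v u + g p w u"
    and g_scale: "\<And>p v u a. v \<in> tspace A p \<Longrightarrow> u \<in> tspace A p \<Longrightarrow> g p (fscale a v) u = a * g p v u"
    and xi: "\<xi> \<in> sections A (rad A g) U"
    and eta: "screen_form A \<S> U \<xi> \<eta>"
    and screen: "\<And>p. p \<in> U \<Longrightarrow> \<S> p \<inter> rad A g p = {0}"
    and D: "is_connection A U D" "torsion_free A U D" "weyl_related A U D g \<theta>"
    and Dg: "is_connection A U Dg" "torsion_free A U Dg" "metric_connection A U Dg g"
    and theta: "\<theta> \<in> hor_forms1 A g U"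
begin

section \<open>Radical, screen projection and the dual vector\<close>

lemma theta_form: "\<theta> \<in> forms1 A U" and theta_hor: "p \<in> U \<Longrightarrow> v \<in> rad A g p \<Longrightarrow> \<theta> p v = 0"
  using theta by (auto simp: hor_forms1_def)

lemma eta_form: "\<eta> \<in> forms1 A U" and eta_xi: "p \<in> U \<Longrightarrow> \<eta> p (\<xi> p) = 1"
  and eta_ker: "p \<in> U \<Longrightarrow> v \<in> \<S> p \<longleftrightarrow> v \<in> tspace A p \<and> \<eta> p v = 0"
  using eta by (auto simp: screen_form_def)

lemma xi_vf: "\<xi> \<in> vfields A U" and xi_rad: "p \<in> U \<Longrightarrow> \<xi> p \<in> rad A g p"
  and xi_t: "p \<in> U \<Longrightarrow> \<xi> p \<in> tspace A p"
  using xi by (auto simp: sections_def rad_def)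

lemma g_diff: "v \<in> tspace A p \<Longrightarrow> w \<in> tspace A p \<Longrightarrow> u \<in> tspace A p \<Longrightarrow>
    g p (v - w) u = g p v u - g p w u"
  using g_add[of "v - w" p w u] tspace_diff by simp

lemma g_rad: "v \<in> rad A g p \<Longrightarrow> w \<in> tspace A p \<Longrightarrow> g p v w = 0" "v \<in> rad A g p \<Longrightarrow> w \<in> tspace A p \<Longrightarrow> g p w v = 0"
  using g_sym by (auto simp: rad_def)

text \<open>The difference of the two sides is radical and annihilated by \<open>\<eta>\<close>, so
  it lies in the screen as well and is zero. Complementarity of screen and radical thus shows
  directly that the radical is the line through \<open>\<xi>\<close>.\<close>

lemma rad_eq:
  assumes p: "p \<in> U" and v: "v \<in> rad A g p"
  shows "v = fscale (\<eta> p v) (\<xi> p)"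
proof -
  have t: "v \<in> tspace A p" using v by (simp add: rad_def)
  let ?d = "v - fscale (\<eta> p v) (\<xi> p)"
  have dt: "?d \<in> tspace A p" using t xi_t[OF p] by (intro tspace_diff tspace_fscale)
  have "\<eta> p ?d = 0"
    by (simp add: forms1D(2,3)[OF eta_form p] t xi_t[OF p] tspace_fscale eta_xi[OF p])
  then have "?d \<in> \<S> p" using eta_ker[OF p] dt by simp
  moreover have "?d \<in> rad A g p"
    using dt g_rad(1)[OF v] g_rad(1)[OF xi_rad[OF p]]
    by (simp add: rad_def g_diff t xi_t[OF p] tspace_fscale g_scale)
  ultimately have "?d = 0" using screen[OF p] by blast
  then show ?thesis by simp
qed

text \<open>An explicit formula in place of the description; its right-hand side depends smoothly on
  the point.\<close>

lemma screen_proj_eq: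
  assumes p: "p \<in> U" and v: "v \<in> tspace A p"
  shows "screen_proj A g \<S> p v = v - fscale (\<eta> p v) (\<xi> p)"
  unfolding screen_proj_def
proof (rule the_equality)
  let ?s = "v - fscale (\<eta> p v) (\<xi> p)"
  have st: "?s \<in> tspace A p" using v xi_t[OF p] by (intro tspace_diff tspace_fscale)
  show "?s \<in> \<S> p \<and> v - ?s \<in> rad A g p"
  proof
    have "\<eta> p ?s = 0"
      by (simp add: forms1D(2,3)[OF eta_form p] v xi_t[OF p] tspace_fscale eta_xi[OF p])
    then show "?s \<in> \<S> p" using eta_ker[OF p] st by simp
    show "v - ?s \<in> rad A g p"
      using xi_t[OF p] g_rad(1)[OF xi_rad[OF p]] by (simp add: rad_def tspace_fscale g_scale)
  qed
  fix s assume s: "s \<in> \<S> p \<and> v - s \<in> rad A g p"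
  have "\<eta> p (v - s) = \<eta> p v" using s v eta_ker[OF p] by (simp add: forms1D(3)[OF eta_form p])
  then have "v - s = fscale (\<eta> p v) (\<xi> p)" using rad_eq[OF p, of "v - s"] s by simp
  then show "s = ?s" by (metis diff_diff_eq2 add_diff_cancel_left')
qed

lemma screen_part_vf:
  assumes V: "open V" "V \<subseteq> U" and Y: "Y \<in> vfields A V"
  obtains Y' where "Y' \<in> vfields A V" "\<And>p. p \<in> V \<Longrightarrow> screen_part A g \<S> Y p = Y' p"
proof
  let ?Y = "\<lambda>q. Y q + fscale (- \<eta> q (Y q)) (\<xi> q)"
  have "smooth_fun A V (\<lambda>q. - \<eta> q (Y q))"
    using smooth_fun_diff[OF V(1) smooth_fun_const[OF V(1), of 0] forms1D(5)[OF eta_form V Y]] by simp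
  then show "?Y \<in> vfields A V"
    by (intro vfields_add Y vfields_fscale vfields_subset[OF xi_vf V(2)])
  fix p assume p: "p \<in> V"
  note t = vfieldsD(1)[OF Y p] and pU = subsetD[OF V(2) p]
  have e: "?Y p = Y p - fscale (\<eta> p (Y p)) (\<xi> p)" by (rule ext) (simp add: fscale_def fun_diff_def)
  show "screen_part A g \<S> Y p = ?Y p" unfolding e using screen_proj_eq[OF pU t] .
qed

text \<open>Adding the square of \<open>\<eta>\<close> to \<open>g\<close> makes it nondegenerate: a
  vector in the kernel pairs to zero with \<open>\<xi>\<close>, hence lies in the screen, and is
  then radical too. For horizontal \<omega>, testing with \<open>\<xi>\<close> gives
  \<open>\<eta>\<close> of the dual vector as \<open>0\<close>, so the added square drops out of its
  defining equation.\<close>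

lemma sharp_props:
  assumes w: "\<omega> \<in> hor_forms1 A g U" and p: "p \<in> U"
  shows "sharp A g \<eta> \<omega> p \<in> tspace A p" "\<And>w. w \<in> tspace A p \<Longrightarrow> g p (sharp A g \<eta> \<omega> p) w = \<omega> p w"
    "\<eta> p (sharp A g \<eta> \<omega> p) = 0"
proof -
  have wf: "\<omega> \<in> forms1 A U" and wh: "\<omega> p (\<xi> p) = 0"
    using w xi_rad[OF p] p by (auto simp: hor_forms1_def)
  note ef = forms1D(1-3)[OF eta_form p]
  let ?b = "\<lambda>u w. g p u w + \<eta> p u * \<eta> p w"
  have ex: "\<exists>u\<in>tspace A p. \<forall>w\<in>tspace A p. \<omega> p w = ?b u w"
  proof (rule nondegenerate_representation)
    fix u assume u: "u \<in> tspace A p" and z: "\<And>w. w \<in> tspace A p \<Longrightarrow> ?b u w = 0"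
    have eu: "\<eta> p u = 0" using z[OF xi_t[OF p]] eta_xi[OF p] g_rad(2)[OF xi_rad[OF p] u] by simp
    then have "u \<in> \<S> p" using u eta_ker[OF p] by simp
    moreover have "u \<in> rad A g p" using z u eu by (simp add: rad_def)
    ultimately show "u = 0" using screen[OF p] by blast
  next
    show "?b u w = ?b w u" for u w using g_sym[of p u w] by simp
  qed (simp_all add: forms1D(1,2)[OF wf p] ef forms1D(2)[OF eta_form p] g_add g_scale algebra_simps)
  then obtain u where u: "u \<in> tspace A p" "\<forall>w\<in>tspace A p. \<omega> p w = ?b u w" by blast
  have uniq: "u' = u" if u': "u' \<in> tspace A p" "\<forall>w\<in>tspace A p. \<omega> p w = ?b u' w" for u'
  proof -
    let ?d = "u' - u"
    have d: "?d \<in> tspace A p" using u u' tspace_diff by blast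
    have e0: "\<eta> p v = 0" if "v \<in> tspace A p" "\<forall>w\<in>tspace A p. \<omega> p w = ?b v w" for v
      using bspec[OF that(2) xi_t[OF p]] wh eta_xi[OF p] g_rad(2)[OF xi_rad[OF p] that(1)] by simp
    have gw: "g p ?d w = 0" if w: "w \<in> tspace A p" for w
      using g_diff[OF u'(1) u(1) w] bspec[OF u(2) w] bspec[OF u'(2) w] e0[OF u] e0[OF u'] by simp
    have "?d \<in> rad A g p" unfolding rad_def using d gw by blast
    moreover have "?d \<in> \<S> p"
      unfolding eta_ker[OF p] using d ef(3)[OF u'(1) u(1)] e0[OF u] e0[OF u'] by simp
    ultimately have "?d = 0" using screen[OF p] by blast
    then show ?thesis by simp
  qed
  have s: "sharp A g \<eta> \<omega> p = u" unfolding sharp_def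
    by (rule the_equality, rule conjI[OF u], elim conjE, rule uniq)
  show "sharp A g \<eta> \<omega> p \<in> tspace A p" using s u by simp
  show e: "\<eta> p (sharp A g \<eta> \<omega> p) = 0"
    using bspec[OF u(2) xi_t[OF p]] wh eta_xi[OF p] g_rad(2)[OF xi_rad[OF p] u(1)] s by simp
  show "\<And>w. w \<in> tspace A p \<Longrightarrow> g p (sharp A g \<eta> \<omega> p) w = \<omega> p w"
    using bspec[OF u(2)] e[unfolded s] unfolding s by simp
qed

section \<open>The difference of the connections and its Koszul identity\<close>

definition \<Delta> :: "'p vfield \<Rightarrow> 'p vfield \<Rightarrow> 'p vfield" where
  "\<Delta> X Y p = Dg X Y p - D X Y p"

lemma Delta_t:
  assumes "open V" "V \<subseteq> U" "p \<in> V" "X \<in> vfields A V" "Y \<in> vfields A V"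
  shows "D X Y p \<in> tspace A p" "Dg X Y p \<in> tspace A p" "\<Delta> X Y p \<in> tspace A p"
proof -
  show 1: "D X Y p \<in> tspace A p" "Dg X Y p \<in> tspace A p"
    using vfieldsD(1)[OF connectionD(1)[OF D(1) assms(1,2,4,5)] assms(3)]
      vfieldsD(1)[OF connectionD(1)[OF Dg(1) assms(1,2,4,5)] assms(3)] .
  show "\<Delta> X Y p \<in> tspace A p" unfolding \<Delta>_def using 1 tspace_diff by blast
qed

lemma Delta_sym:
  assumes "open V" "V \<subseteq> U" "p \<in> V" "X \<in> vfields A V" "Y \<in> vfields A V"
  shows "\<Delta> X Y p = \<Delta> Y X p"
proof -
  have "D X Y p - D Y X p = lie_bracket A X Y p" "Dg X Y p - Dg Y X p = lie_bracket A X Y p"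
    using D(2) Dg(2) assms by (simp_all add: torsion_free_def)
  then have "Dg X Y p - Dg Y X p = D X Y p - D Y X p" by simp
  then show ?thesis by (simp add: \<Delta>_def algebra_simps)
qed

lemma Delta_g:
  assumes V: "open V" "V \<subseteq> U" "p \<in> V" and X: "X \<in> vfields A V" and Y: "Y \<in> vfields A V"
    and Z: "Z \<in> vfields A V"
  shows "g p (\<Delta> X Y p) (Z p) =
    \<theta> p (Z p) * g p (X p) (Y p) - \<theta> p (X p) * g p (Y p) (Z p) - \<theta> p (Y p) * g p (X p) (Z p)"
proof -
  \<comment> \<open>Subtracting the two covariant derivatives of \<open>g\<close> removes the
    derivative of the function \<open>g (Y, Z)\<close>, which leaves an algebraic identity.\<close>
  have K: "g p (\<Delta> X Y p) (Z p) + g p (\<Delta> X Z p) (Y p) = - 2 * \<theta> p (X p) * g p (Y p) (Z p)"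
    if XYZ: "X \<in> vfields A V" "Y \<in> vfields A V" "Z \<in> vfields A V" for X Y Z
  proof -
    have "cov_deriv2 D g X Y Z p = - 2 * \<theta> p (X p) * g p (Y p) (Z p)" "cov_deriv2 Dg g X Y Z p = 0"
      using D(3) Dg(3) V XYZ by (simp_all add: metric_connection_def weyl_related_def)
    then show ?thesis
      using Delta_t[OF V XYZ(1,2)] Delta_t[OF V XYZ(1,3)] vfieldsD(1)[OF XYZ(2) V(3)]
        vfieldsD(1)[OF XYZ(3) V(3)] g_sym[of p "Y p" "D X Z p"] g_sym[of p "Y p" "Dg X Z p"]
      by (simp add: cov_deriv2_def g_diff \<Delta>_def)
  qed
  \<comment> \<open>Koszul combination: the first two instances minus the third. By symmetry of
    \<open>\<Delta>\<close> all terms cancel except twice the left-hand side.\<close>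
  show ?thesis
    using K[OF X Y Z] K[OF Y Z X] K[OF Z X Y] Delta_sym[OF V X Y] Delta_sym[OF V Y Z]
      Delta_sym[OF V Z X] g_sym[of p "Z p" "X p"] g_sym[of p "X p" "Y p"] g_sym[of p "Y p" "Z p"]
    by (simp add: algebra_simps)
qed

section \<open>The tensor \<open>S\<close>\<close>

abbreviation H :: "'p vfield \<Rightarrow> 'p vfield \<Rightarrow> 'p \<Rightarrow> real" where
  "H X Y p \<equiv> \<eta> p (\<Delta> X Y p) + \<theta> p (X p) * \<eta> p (Y p) + \<theta> p (Y p) * \<eta> p (X p)"

text \<open>Well defined since \<open>\<Delta>\<close> is tensorial; extensional like every element of \<open>sym_forms2\<close>.\<close>
definition S :: "'p form2" where
  "S p v w = (if p \<in> U \<and> v \<in> tspace A p \<and> w \<in> tspace A p then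
     (THE s. \<exists>V X Y. open V \<and> V \<subseteq> U \<and> p \<in> V \<and> X \<in> vfields A V \<and> Y \<in> vfields A V \<and>
        X p = v \<and> Y p = w \<and> s = H X Y p) else 0)"

lemma S_eq:
  assumes V: "open V" "V \<subseteq> U" "p \<in> V" and X: "X \<in> vfields A V" and Y: "Y \<in> vfields A V"
  shows "S p (X p) (Y p) = H X Y p"
proof -
  have "(THE s. \<exists>V X' Y'. open V \<and> V \<subseteq> U \<and> p \<in> V \<and> X' \<in> vfields A V \<and> Y' \<in> vfields A V \<and>
        X' p = X p \<and> Y' p = Y p \<and> s = H X' Y' p) = H X Y p"
  proof (rule the_equality)
    fix s assume "\<exists>V X' Y'. open V \<and> V \<subseteq> U \<and> p \<in> V \<and> X' \<in> vfields A V \<and> Y' \<in> vfields A V \<and>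
        X' p = X p \<and> Y' p = Y p \<and> s = H X' Y' p"
    then obtain V' X' Y' where V': "open V'" "V' \<subseteq> U" "p \<in> V'" "X' \<in> vfields A V'" "Y' \<in> vfields A V'"
      and e: "X' p = X p" "Y' p = Y p" and s: "s = H X' Y' p" by blast
    show "s = H X Y p"
      using connection_diff_tensorial[OF Dg(1) D(1) V' V X Y e] by (simp add: s e \<Delta>_def)
  qed (use assms in blast)
  then show ?thesis
    using V vfieldsD(1)[OF X V(3)] vfieldsD(1)[OF Y V(3)] by (simp add: S_def subset_iff)
qed

lemma extend:
  assumes p: "p \<in> U"
  obtains V where "open V" "V \<subseteq> U" "p \<in> V" "\<forall>v\<in>tspace A p. \<exists>X\<in>vfields A V. X p = v"
proof -
  obtain W where W: "open W" "p \<in> W" "\<forall>v\<in>tspace A p. \<exists>X\<in>vfields A W. X p = v" using extend_tvec .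
  show thesis
  proof (rule that[of "W \<inter> U"])
    show "\<forall>v\<in>tspace A p. \<exists>X\<in>vfields A (W \<inter> U). X p = v"
      using W(3) vfields_subset[of _ W "W \<inter> U"] by blast
  qed (use W U p in auto)
qed

lemma S_form: "S \<in> sym_forms2 A U"
proof -
  have sym: "S p v w = S p w v" for p v w
  proof (cases "p \<in> U \<and> v \<in> tspace A p \<and> w \<in> tspace A p")
    case True
    obtain V where V: "open V" "V \<subseteq> U" "p \<in> V" and ex: "\<forall>v\<in>tspace A p. \<exists>X\<in>vfields A V. X p = v"
      using extend True by blast
    obtain X Y where X: "X \<in> vfields A V" "X p = v" and Y: "Y \<in> vfields A V" "Y p = w"
      using ex True by metis
    show ?thesis using S_eq[OF V X(1) Y(1)] S_eq[OF V Y(1) X(1)] Delta_sym[OF V X(1) Y(1)] X Y by simp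
  qed (auto simp: S_def)
  have lin: "linear_on (tspace A p) (S p v)" if p: "p \<in> U" and v: "v \<in> tspace A p" for p v
  proof -
    obtain V where V: "open V" "V \<subseteq> U" "p \<in> V" and ex: "\<forall>v\<in>tspace A p. \<exists>X\<in>vfields A V. X p = v"
      using extend p by blast
    obtain X where X: "X \<in> vfields A V" "X p = v" using ex v by metis
    note ef = forms1D(1-3)[OF eta_form p] forms1D(1,2)[OF theta_form p]
    show ?thesis
      unfolding linear_on_def
    proof (intro conjI ballI allI)
      fix w assume w: "w \<in> tspace A p"
      then obtain Y where Y: "Y \<in> vfields A V" "Y p = w" using ex by metis
      note tY = Delta_t[OF V X(1) Y(1)]
      {
        fix w' assume w': "w' \<in> tspace A p"
        then obtain Y' where Y': "Y' \<in> vfields A V" "Y' p = w'" using ex by metis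
        have "\<Delta> X (\<lambda>q. Y q + Y' q) p = \<Delta> X Y p + \<Delta> X Y' p"
          unfolding connectionD(5)[OF D(1) V(1,2) X(1) Y(1) Y'(1) V(3)]
            connectionD(5)[OF Dg(1) V(1,2) X(1) Y(1) Y'(1) V(3)] \<Delta>_def by (simp add: algebra_simps)
        then show "S p v (w + w') = S p v w + S p v w'"
          using S_eq[OF V X(1) vfields_add[OF Y(1) Y'(1)]] S_eq[OF V X(1) Y(1)] S_eq[OF V X(1) Y'(1)]
            Delta_t(3)[OF V X(1) Y(1)] Delta_t(3)[OF V X(1) Y'(1)] X Y Y' w w'
          by (simp only: ef) (simp add: algebra_simps)
      }
      fix a
      have c0: "X p (\<lambda>q. a) = 0" using tvec_derivation(4) X v by simp
      have "\<Delta> X (\<lambda>q. fscale a (Y q)) p = fscale a (\<Delta> X Y p)"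
        using connectionD(6)[OF D(1) V(1,2) X(1) Y(1) smooth_fun_const[OF V(1), of a] V(3)]
          connectionD(6)[OF Dg(1) V(1,2) X(1) Y(1) smooth_fun_const[OF V(1), of a] V(3)] c0
        by (auto simp: fun_eq_iff algebra_simps fun_diff_def \<Delta>_def)
      then show "S p v (fscale a w) = a * S p v w"
        using S_eq[OF V X(1) vfields_fscale[OF Y(1) smooth_fun_const[OF V(1), of a]]] S_eq[OF V X(1) Y(1)]
          tY(3) X Y w by (simp only: ef) (simp add: algebra_simps)
    qed
  qed
  have smooth: "smooth_fun A V (\<lambda>p. S p (X p) (Y p))"
    if V: "open V" "V \<subseteq> U" "X \<in> vfields A V" "Y \<in> vfields A V" for V X Y
  proof (rule smooth_fun_cong[OF V(1)])
    \<comment> \<open>\<open>Dg X Y\<close> and \<open>D X Y\<close> are kept apart because each is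
      a vector field, so the smoothness clause for the form \<open>\<eta>\<close> applies to
      each.\<close>
    let ?H = "\<lambda>p. \<eta> p (Dg X Y p) - \<eta> p (D X Y p) + \<theta> p (X p) * \<eta> p (Y p) + \<theta> p (Y p) * \<eta> p (X p)"
    show "smooth_fun A V ?H"
      using V connectionD(1)[OF D(1) V] connectionD(1)[OF Dg(1) V]
      by (intro smooth_fun_add smooth_fun_diff smooth_fun_mult forms1D(5)[OF eta_form]
          forms1D(5)[OF theta_form])
    fix q assume q: "q \<in> V"
    then show "?H q = S q (X q) (Y q)"
      using S_eq[OF V(1,2) q V(3,4)] Delta_t[OF V(1,2) q V(3,4)] forms1D(3)[OF eta_form, of q] V(2)
      by (auto simp: \<Delta>_def)
  qed
  show ?thesis
    unfolding sym_forms2_def using sym lin smooth by (auto simp: S_def)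
qed

section \<open>The formula, its uniqueness and the values of \<open>S\<close>\<close>

lemma formula: "weyl_formula A U D Dg g \<eta> \<xi> \<theta> S"
  unfolding weyl_formula_def
proof (intro allI impI ballI)
  fix V X Y p assume "open V \<and> V \<subseteq> U \<and> X \<in> vfields A V \<and> Y \<in> vfields A V" "p \<in> V"
  then have V: "open V" "V \<subseteq> U" "p \<in> V" and X: "X \<in> vfields A V" and Y: "Y \<in> vfields A V" by auto
  have p: "p \<in> U" using V by auto
  let ?s = "sharp A g \<eta> \<theta> p"
  define T where "T = \<Delta> X Y p + fscale (\<theta> p (X p)) (Y p) + fscale (\<theta> p (Y p)) (X p) - fscale (g p (X p) (Y p)) ?s"
  note s = sharp_props[OF theta p]
  have t: "X p \<in> tspace A p" "Y p \<in> tspace A p" "\<Delta> X Y p \<in> tspace A p"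
    using vfieldsD(1)[OF X V(3)] vfieldsD(1)[OF Y V(3)] Delta_t(3)[OF V X Y] .
  have Tt: "T \<in> tspace A p"
    unfolding T_def using t s by (intro tspace_add tspace_diff tspace_fscale)
  have "T \<in> rad A g p"
    unfolding rad_def
  proof (intro CollectI conjI ballI Tt)
    fix w assume w: "w \<in> tspace A p"
    obtain V' where V': "open V'" "V' \<subseteq> U" "p \<in> V'" and ex: "\<forall>v\<in>tspace A p. \<exists>X\<in>vfields A V'. X p = v"
      using extend p by blast
    obtain Z where Z: "Z \<in> vfields A V'" "Z p = w" using ex w by metis
    \<comment> \<open>The test field \<open>Z\<close> lives on its own neighbourhood, while the
      Koszul identity needs all three fields on one domain.\<close>
    let ?V = "V \<inter> V'"
    have O: "open ?V" "?V \<subseteq> U" "p \<in> ?V" "X \<in> vfields A ?V" "Y \<in> vfields A ?V" "Z \<in> vfields A ?V"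
      using V V' X Y Z vfields_subset[of _ V ?V] vfields_subset[of _ V' ?V] by auto
    have "g p T w = g p (\<Delta> X Y p) w + \<theta> p (X p) * g p (Y p) w + \<theta> p (Y p) * g p (X p) w -
      g p (X p) (Y p) * \<theta> p w"
      unfolding T_def using t s w
      by (simp add: g_add g_diff g_scale tspace_add tspace_fscale)
    then show "g p T w = 0" using Delta_g[OF O] Z by simp
  qed
  then have "T = fscale (\<eta> p T) (\<xi> p)" by (rule rad_eq[OF p])
  \<comment> \<open>The dual vector of \<open>\<theta>\<close> contributes nothing, being
    annihilated by \<open>\<eta>\<close>.\<close>
  moreover have "\<eta> p T = S p (X p) (Y p)"
    unfolding T_def S_eq[OF V X Y] using t s
    by (simp add: forms1D(1-3)[OF eta_form p] tspace_add tspace_fscale)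
  ultimately have "T = fscale (S p (X p) (Y p)) (\<xi> p)" by simp
  then show "D X Y p = Dg X Y p + fscale (\<theta> p (X p)) (Y p) + fscale (\<theta> p (Y p)) (X p)
          - fscale (g p (X p) (Y p)) ?s - fscale (S p (X p) (Y p)) (\<xi> p)"
    unfolding T_def \<Delta>_def by (simp add: algebra_simps)
qed

text \<open>Pairing the formula with \<open>g\<close> removes the multiple of \<open>\<xi>\<close>,
  so \<open>\<theta>'\<close> satisfies the same Koszul identity as \<open>\<theta>\<close>;
  comparing the two determines the form wherever \<open>g\<close> is nonzero, and horizontality
  takes care of the rest. Once the forms agree, so do the multiples of \<open>\<xi>\<close>, and
  \<open>\<eta>\<close> reads off their coefficients.\<close>

lemma formula_unique:
  assumes th': "\<theta>' \<in> hor_forms1 A g U" and S': "S' \<in> sym_forms2 A U"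
    and F: "weyl_formula A U D Dg g \<eta> \<xi> \<theta>' S'"
  shows "\<theta>' = \<theta>" "S' = S"
proof -
  have thf: "\<theta>' \<in> forms1 A U" using th' by (simp add: hor_forms1_def)
  have id: "\<theta>' p v * g p u w + \<theta>' p u * g p v w - g p v u * \<theta>' p w =
      \<theta> p v * g p u w + \<theta> p u * g p v w - g p v u * \<theta> p w"
    if p: "p \<in> U" and t: "v \<in> tspace A p" "u \<in> tspace A p" "w \<in> tspace A p" for p v u w
  proof -
    obtain V where V: "open V" "V \<subseteq> U" "p \<in> V" and ex: "\<forall>v\<in>tspace A p. \<exists>X\<in>vfields A V. X p = v"
      using extend p by blast
    obtain X Y Z where X: "X \<in> vfields A V" "X p = v" and Y: "Y \<in> vfields A V" "Y p = u"
      and Z: "Z \<in> vfields A V" "Z p = w" using ex t by metis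
    note s = sharp_props[OF th' p]
    have "D X Y p = Dg X Y p + fscale (\<theta>' p v) u + fscale (\<theta>' p u) v
        - fscale (g p v u) (sharp A g \<eta> \<theta>' p) - fscale (S' p v u) (\<xi> p)"
      using F V X Y unfolding weyl_formula_def by auto
    then have "\<Delta> X Y p = fscale (g p v u) (sharp A g \<eta> \<theta>' p) + fscale (S' p v u) (\<xi> p)
        - fscale (\<theta>' p v) u - fscale (\<theta>' p u) v" by (simp add: \<Delta>_def algebra_simps)
    then have "g p (\<Delta> X Y p) w = g p v u * \<theta>' p w - \<theta>' p v * g p u w - \<theta>' p u * g p v w"
      using t s xi_t[OF p] g_rad(1)[OF xi_rad[OF p]]
      by (simp add: g_add g_diff g_scale tspace_add tspace_diff tspace_fscale)
    then show ?thesis using Delta_g[OF V X(1) Y(1) Z(1)] X Y Z by (simp add: algebra_simps)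
  qed
  show th: "\<theta>' = \<theta>"
  proof (intro ext)
    fix p v
    show "\<theta>' p v = \<theta> p v"
    proof (cases "p \<in> U \<and> v \<in> tspace A p")
      case True
      then have p: "p \<in> U" and v: "v \<in> tspace A p" by auto
      show ?thesis
      proof (cases "\<exists>u\<in>tspace A p. g p u u \<noteq> 0")
        case True
        then obtain u where u: "u \<in> tspace A p" "g p u u \<noteq> 0" by blast
        \<comment> \<open>With second and third argument equal, two terms of the identity cancel and
          only the form at \<open>v\<close> times \<open>g p u u\<close> is left.\<close>
        then show ?thesis using id[OF p v u(1) u(1)] by (simp add: algebra_simps)
      next
        \<comment> \<open>By polarization \<open>g\<close> vanishes at \<open>p\<close>, so
          \<open>v\<close> is radical and both horizontal forms are zero on it.\<close>
        case False
        have "v \<in> rad A g p"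
          unfolding rad_def
        proof (intro CollectI conjI ballI v)
          fix w assume w: "w \<in> tspace A p"
          have "g p (v + w) (v + w) = g p v v + 2 * g p v w + g p w w"
            using v w tspace_add[OF v w] g_sym[of p v "v + w"] g_sym[of p w "v + w"] g_sym[of p w v]
            by (simp add: g_add)
          then show "g p v w = 0" using False v w tspace_add[OF v w] by simp
        qed
        then show ?thesis using theta_hor[OF p] th' p by (simp add: hor_forms1_def)
      qed
    next
      case False
      then show ?thesis using forms1D(4)[OF thf] forms1D(4)[OF theta_form] by auto
    qed
  qed
  show "S' = S"
  proof (intro ext)
    fix p v u
    show "S' p v u = S p v u"
    proof (cases "p \<in> U \<and> v \<in> tspace A p \<and> u \<in> tspace A p")
      case True
      obtain V where V: "open V" "V \<subseteq> U" "p \<in> V" and ex: "\<forall>v\<in>tspace A p. \<exists>X\<in>vfields A V. X p = v"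
        using extend True by blast
      obtain X Y where X: "X \<in> vfields A V" "X p = v" and Y: "Y \<in> vfields A V" "Y p = u"
        using ex True by metis
      let ?R = "Dg X Y p + fscale (\<theta> p (X p)) (Y p) + fscale (\<theta> p (Y p)) (X p)
        - fscale (g p (X p) (Y p)) (sharp A g \<eta> \<theta> p)"
      have "D X Y p = ?R - fscale (S' p (X p) (Y p)) (\<xi> p)"
        using F[unfolded th weyl_formula_def] V X(1) Y(1) by blast
      moreover have "D X Y p = ?R - fscale (S p (X p) (Y p)) (\<xi> p)"
        using formula[unfolded weyl_formula_def] V X(1) Y(1) by blast
      ultimately have "?R - fscale (S' p v u) (\<xi> p) = ?R - fscale (S p v u) (\<xi> p)" using X Y by metis
      then have "fscale (S' p v u) (\<xi> p) = fscale (S p v u) (\<xi> p)" by (rule diff_left_imp_eq)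
      then have "\<eta> p (fscale (S' p v u) (\<xi> p)) = \<eta> p (fscale (S p v u) (\<xi> p))"
        by (rule arg_cong)
      then show ?thesis using forms1D(2)[OF eta_form] xi_t eta_xi True by simp
    next
      case False
      then show ?thesis using S' by (auto simp: sym_forms2_def S_def)
    qed
  qed
qed

text \<open>The normalisation of \<open>\<xi>\<close> for both connections gives
  \<open>\<Delta> \<xi> \<xi> = 0\<close>, and \<open>\<theta>\<close> vanishes on
  \<open>\<xi>\<close>. Since the radical is spanned by \<open>\<xi>\<close>, bilinearity does the
  rest.\<close>

lemma S_rad:
  assumes DD: "\<forall>p\<in>U. D \<xi> \<xi> p = 0" "\<forall>p\<in>U. Dg \<xi> \<xi> p = 0" and p: "p \<in> U"
    and v: "v \<in> rad A g p" and w: "w \<in> rad A g p"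
  shows "S p v w = 0"
proof -
  have 0: "S p (\<xi> p) (\<xi> p) = 0"
    using S_eq[OF U order_refl p xi_vf xi_vf] DD p theta_hor[OF p xi_rad[OF p]]
      forms1D(6)[OF eta_form p] by (simp add: \<Delta>_def)
  have "S p v w = S p (fscale (\<eta> p v) (\<xi> p)) (fscale (\<eta> p w) (\<xi> p))"
    using rad_eq[OF p v] rad_eq[OF p w] by simp
  also have "\<dots> = 0"
    using 0 xi_t[OF p] by (simp add: sym_forms2D(2,4)[OF S_form p] tspace_fscale)
  finally show ?thesis .
qed

text \<open>Extending \<open>w\<close> by a screen-valued field is what brings in both hypotheses:
  \<open>\<eta>\<close> kills the Weyl derivative of that field, while on its
  \<open>Dg\<close>-derivative it reads off \<open>C\<close>. The term with
  \<open>\<eta> p w\<close> drops out because \<open>w\<close> lies in the screen.\<close>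

lemma S_screen:
  assumes DS: "\<And>V X Y. open V \<Longrightarrow> X \<in> vfields A V \<Longrightarrow> Y \<in> vfields A V \<Longrightarrow>
      D X (screen_part A g \<S> Y) \<in> sections A \<S> V"
    and C: "screen_second_form A g \<S> U \<xi> Dg C"
    and p: "p \<in> U" and v: "v \<in> tspace A p" and w: "w \<in> \<S> p"
  shows "S p v w = C p v w + \<eta> p v * \<theta> p w"
proof -
  have wt: "w \<in> tspace A p" and ew: "\<eta> p w = 0" using w eta_ker[OF p] by auto
  obtain V where V: "open V" "V \<subseteq> U" "p \<in> V" and ex: "\<forall>v\<in>tspace A p. \<exists>X\<in>vfields A V. X p = v"
    using extend p by blast
  obtain X Y where X: "X \<in> vfields A V" "X p = v" and Y: "Y \<in> vfields A V" "Y p = w"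
    using ex v wt by metis
  let ?P = "screen_part A g \<S> Y"
  \<comment> \<open>\<open>w\<close> is fixed by the projection, so the projected field still
    extends it.\<close>
  have Pp: "?P p = w" using screen_proj_eq[OF p wt] Y ew by (simp add: fscale_def fun_diff_def)
  obtain Y' where Y': "Y' \<in> vfields A V" "\<And>q. q \<in> V \<Longrightarrow> ?P q = Y' q" using screen_part_vf[OF V(1,2) Y(1)] by metis
  \<comment> \<open>The projected field coincides with the explicit field \<open>Y'\<close> only on
    \<open>V\<close>, so membership in \<open>vfields\<close> is transferred by locality.\<close>
  have Pv: "?P \<in> vfields A V"
    unfolding vfields_def
  proof (intro CollectI conjI ballI allI impI)
    show "?P q \<in> tspace A q" if "q \<in> V" for q using Y'(2)[OF that] vfieldsD(1)[OF Y'(1) that] by simp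
    fix W h assume W: "open W \<and> W \<subseteq> V \<and> smooth_fun A W h"
    show "smooth_fun A W (\<lambda>q. ?P q h)"
      by (rule smooth_fun_cong[of W "\<lambda>q. Y' q h"])
        (use W Y'(2) vfieldsD(2)[OF Y'(1), of W h] in \<open>auto simp: subset_iff\<close>)
  qed
  have "D X ?P p \<in> \<S> p" using DS[OF V(1) X(1) Y(1)] V(3) by (simp add: sections_def)
  then have 1: "\<eta> p (D X ?P p) = 0" using eta_ker[OF p] by simp
  obtain Z where Z: "Z \<in> sections A \<S> V"
    "\<forall>p\<in>V. Dg X ?P p = Z p + fscale (C p (X p) (screen_proj A g \<S> p (Y p))) (\<xi> p)"
    using C V X Y unfolding screen_second_form_def by blast
  have "Z p \<in> \<S> p" using Z(1) V(3) by (simp add: sections_def)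
  then have Zp: "Z p \<in> tspace A p" "\<eta> p (Z p) = 0" using eta_ker[OF p] by auto
  have "\<eta> p (Dg X ?P p) = C p v w"
    using bspec[OF Z(2) V(3)] Pp X Zp xi_t[OF p]
    by (simp add: forms1D(1,2)[OF eta_form p] tspace_fscale eta_xi[OF p])
  then have "\<eta> p (\<Delta> X ?P p) = C p v w"
    using 1 forms1D(3)[OF eta_form p] Delta_t[OF V X(1) Pv] by (simp add: \<Delta>_def)
  then show ?thesis using S_eq[OF V X(1) Pv] Pp X ew by simp
qed

end

section \<open>Assembly: global horizontality and the formula over \<open>U\<close>\<close>

theorem lemma3p2:
  fixes n :: nat
    and A :: "('p::{t2_space, second_countable_topology}, 'b::euclidean_space) atlas"
    and B :: "('q::{t2_space, second_countable_topology}, 'e::euclidean_space) atlas"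
    and \<iota> :: "'p \<Rightarrow> 'q"
    and G :: "'q form2"
    and N :: "'q vfield \<Rightarrow> 'q vfield \<Rightarrow> 'q vfield"
    and g0 :: "'p form2"
    and \<S> :: "'p \<Rightarrow> 'p tvec set"
    and D :: "'p vfield \<Rightarrow> 'p vfield \<Rightarrow> 'p vfield"
  assumes "lightlike_hypersurface n A B \<iota> G"
    and "g0 = induced_metric A B \<iota> G"
    and "levi_civita B G N"
    and "totally_geodesic A B \<iota> G N"
    and "screen_distribution A n g0 \<S>"
    and "integrable_hyperplanes A \<S>"
    and "weyl_screen_structure A g0 \<S> D"
  shows "(\<forall>g\<in>conf_class A g0. weyl_form A D g \<in> hor_forms1 A g0 UNIV) \<and>
    (\<forall>g\<in>conf_class A g0. \<forall>U \<xi> \<eta> Dg C.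
      open U \<and>
      \<xi> \<in> sections A (rad A g0) U \<and> (\<forall>p\<in>U. \<xi> p \<noteq> 0) \<and> (\<forall>p\<in>U. D \<xi> \<xi> p = 0) \<and>
      screen_form A \<S> U \<xi> \<eta> \<and>
      is_connection A U Dg \<and> torsion_free A U Dg \<and> metric_connection A U Dg g \<and>
      (\<forall>p\<in>U. Dg \<xi> \<xi> p = 0) \<and>
      screen_second_form A g0 \<S> U \<xi> Dg C \<longrightarrow>
      (\<exists>\<theta> S.
        \<theta> \<in> hor_forms1 A g0 U \<and> S \<in> sym_forms2 A U \<and> weyl_formula A U D Dg g \<eta> \<xi> \<theta> S \<and>
        (\<forall>\<theta>' S'. \<theta>' \<in> hor_forms1 A g0 U \<and> S' \<in> sym_forms2 A U \<and>
           weyl_formula A U D Dg g \<eta> \<xi> \<theta>' S' \<longrightarrow> \<theta>' = \<theta> \<and> S' = S) \<and>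
        (\<forall>p\<in>U. \<theta> p = weyl_form A D g p) \<and>
        (\<forall>p\<in>U. \<forall>v\<in>rad A g0 p. \<forall>w\<in>rad A g0 p. S p v w = 0) \<and>
        (\<forall>p\<in>U. \<forall>v\<in>tspace A p. \<forall>w\<in>\<S> p. S p v w = C p v w + \<eta> p v * \<theta> p w)))"
proof -
  have A: "smooth_atlas A" and B: "smooth_atlas B" and G: "G \<in> sym_forms2 B UNIV"
    and imm: "immersion A B \<iota>" and rk: "\<And>p. form_rank (tspace A p) (g0 p) = n"
    using assms(1,2) by (auto simp: lightlike_hypersurface_def lorentzian_metric_def)
  interpret M: smooth_mfd A by unfold_locales (rule A)
  interpret Q: smooth_mfd B by unfold_locales (rule B)
  interpret am: ambient A B \<iota> G N by unfold_locales (rule imm G assms(3))+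
  note g0 = assms(2)
  note bil = am.induced_metric_bilinear[folded g0]
  have D: "is_connection A UNIV D" "torsion_free A UNIV D"
    and Dw: "\<And>g. g \<in> conf_class A g0 \<Longrightarrow> \<exists>!\<theta>. \<theta> \<in> forms1 A UNIV \<and> weyl_related A UNIV D g \<theta>"
    and DS: "\<And>V X Y. open V \<Longrightarrow> X \<in> vfields A V \<Longrightarrow> Y \<in> vfields A V \<Longrightarrow>
      D X (screen_part A g0 \<S> Y) \<in> sections A \<S> V"
    using assms(7) by (auto simp: weyl_screen_structure_def weyl_structure_def)
  have rad_conf: "rad A g = rad A g0" and bil_g: "g p v w = g p w v"
    "v \<in> tspace A p \<Longrightarrow> w \<in> tspace A p \<Longrightarrow> u \<in> tspace A p \<Longrightarrow> g p (v + w) u = g p v u + g p w u"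
    "v \<in> tspace A p \<Longrightarrow> u \<in> tspace A p \<Longrightarrow> g p (fscale a v) u = a * g p v u"
    if gc: "g \<in> conf_class A g0" for g p v w u a
  proof -
    obtain f where g: "g = (\<lambda>p v w. exp (- 2 * f p) * g0 p v w)"
      using gc unfolding conf_class_def by blast
    show "rad A g = rad A g0" by (simp add: rad_def g fun_eq_iff)
    show "g p v w = g p w v" by (simp add: g bil(1)[of p v])
    show "v \<in> tspace A p \<Longrightarrow> w \<in> tspace A p \<Longrightarrow> u \<in> tspace A p \<Longrightarrow> g p (v + w) u = g p v u + g p w u"
      by (simp add: g bil(2) algebra_simps)
    show "v \<in> tspace A p \<Longrightarrow> u \<in> tspace A p \<Longrightarrow> g p (fscale a v) u = a * g p v u"
      by (simp add: g bil(3))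
  qed
  have wf: "weyl_form A D g \<in> forms1 A UNIV" "weyl_related A UNIV D g (weyl_form A D g)"
    if "g \<in> conf_class A g0" for g
    using theI'[OF Dw[OF that]] by (simp_all add: weyl_form_def)
  have hor: "weyl_form A D g p v = 0" if g: "g \<in> conf_class A g0" and v: "v \<in> rad A g0 p" for g p v
  proof (cases "\<exists>u\<in>tspace A p. g p u u \<noteq> 0")
    case True
    then obtain u where u: "u \<in> tspace A p" "g p u u \<noteq> 0" by blast
    obtain f where f: "smooth_fun A UNIV f" "\<forall>p. \<forall>v\<in>rad A g0 p. v f = 0"
      and ge: "g = (\<lambda>p v w. exp (- 2 * f p) * g0 p v w)"
      using g by (auto simp: conf_class_def)
    have fr: "v f = 0" if "v \<in> rad A (induced_metric A B \<iota> G) p" for v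
      using f(2) that unfolding g0 by blast
    show ?thesis
    proof (rule am.weyl_form_rad[where f=f and g=g and u=u and \<theta>="weyl_form A D g" and D=D])
      show "g = (\<lambda>p v w. exp (- 2 * f p) * induced_metric A B \<iota> G p v w)"
        using ge unfolding g0 .
      show "v \<in> rad A (induced_metric A B \<iota> G) p" using v unfolding g0 .
    qed (fact assms(4) f(1) fr D wf(2)[OF g] u)+
  next
    case False
    have gz: "g p v w = 0" if v: "v \<in> tspace A p" and w: "w \<in> tspace A p" for v w
    proof -
      have "g p (v + w) (v + w) = g p v v + 2 * g p v w + g p w w"
        using v w M.tspace_add[OF v w] bil_g(1)[OF g, of p v "v + w"] bil_g(1)[OF g, of p w "v + w"]
          bil_g(1)[OF g, of p w v] by (simp add: bil_g(2)[OF g])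
      then show ?thesis using False v w M.tspace_add[OF v w] by simp
    qed
    obtain f where ge: "g = (\<lambda>p v w. exp (- 2 * f p) * g0 p v w)"
      using g unfolding conf_class_def by blast
    have z: "g0 p v w = 0" if "v \<in> tspace A p" "w \<in> tspace A p" for v w
      using gz[OF that] by (simp add: ge)
    \<comment> \<open>The zero form has zero image, which is the span of the empty set; constancy of
      the rank then spreads the degeneracy from \<open>p\<close> to the whole hypersurface.\<close>
    have "(\<lambda>v w. if w \<in> tspace A p then g0 p v w else 0) ` tspace A p \<subseteq> fvs.span {}"
      using z by (auto simp: fun_eq_iff)
    then have "form_rank (tspace A p) (g0 p) \<le> 0"
      unfolding form_rank_def using fvs.dim_le_card[of _ "{}"] by simp
    then have n: "n = 0" using rk by simp
    \<comment> \<open>For \<open>n = 0\<close> the screen is zero at every point, so its complement,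
      the radical, is the whole tangent space.\<close>
    have "g0 q v w = 0" for q v w
    proof (cases "v \<in> tspace A q \<and> w \<in> tspace A q")
      case True
      have "\<S> q = {0}"
      proof -
        have "distribution A 0 \<S>" using assms(5) n by (simp add: screen_distribution_def)
        then obtain V where "q \<in> V" "\<forall>r\<in>V. \<S> r = fvs.span {}"
          unfolding distribution_def by auto
        then show ?thesis by simp
      qed
      moreover have "{s + r |s r. s \<in> \<S> q \<and> r \<in> rad A g0 q} = tspace A q"
        using assms(5) by (simp add: screen_distribution_def)
      ultimately have "v \<in> rad A g0 q" using True by auto
      then show ?thesis using True by (simp add: rad_def)
    qed (auto simp: g0 induced_metric_def)
    then have g0z: "g q v w = 0" for q v w by (simp add: ge)
    have "weyl_related A UNIV D g (\<lambda>p v. 0)"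
      using M.tvec_derivation(4)[OF M.vfieldsD(1)] by (auto simp: weyl_related_def cov_deriv2_def g0z)
    moreover have "(\<lambda>p v. 0) \<in> forms1 A UNIV"
      by (auto simp: forms1_def linear_on_def M.smooth_fun_const)
    ultimately have "weyl_form A D g = (\<lambda>p v. 0)" using Dw[OF g] wf[OF g] by blast
    then show ?thesis by simp
  qed
  have part1: "weyl_form A D g \<in> hor_forms1 A g0 UNIV" if "g \<in> conf_class A g0" for g
    using wf(1) hor that by (auto simp: hor_forms1_def)
  have part2: "\<exists>\<theta> S.
        \<theta> \<in> hor_forms1 A g0 U \<and> S \<in> sym_forms2 A U \<and> weyl_formula A U D Dg g \<eta> \<xi> \<theta> S \<and>
        (\<forall>\<theta>' S'. \<theta>' \<in> hor_forms1 A g0 U \<and> S' \<in> sym_forms2 A U \<and>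
           weyl_formula A U D Dg g \<eta> \<xi> \<theta>' S' \<longrightarrow> \<theta>' = \<theta> \<and> S' = S) \<and>
        (\<forall>p\<in>U. \<theta> p = weyl_form A D g p) \<and>
        (\<forall>p\<in>U. \<forall>v\<in>rad A g0 p. \<forall>w\<in>rad A g0 p. S p v w = 0) \<and>
        (\<forall>p\<in>U. \<forall>v\<in>tspace A p. \<forall>w\<in>\<S> p. S p v w = C p v w + \<eta> p v * \<theta> p w)"
    if g: "g \<in> conf_class A g0" and U: "open U" and xi: "\<xi> \<in> sections A (rad A g0) U"
      and Dxi: "\<forall>p\<in>U. D \<xi> \<xi> p = 0" "\<forall>p\<in>U. Dg \<xi> \<xi> p = 0" and eta: "screen_form A \<S> U \<xi> \<eta>"
      and Dg: "is_connection A U Dg" "torsion_free A U Dg" "metric_connection A U Dg g"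
      and C: "screen_second_form A g0 \<S> U \<xi> Dg C" for g U \<xi> \<eta> Dg C
  proof -
    \<comment> \<open>The Weyl form lives on the whole manifold; cutting it off outside
      \<open>U\<close> makes it an extensional form on \<open>U\<close>, as equality of functions in
      the uniqueness claim demands.\<close>
    let ?t = "\<lambda>p v. if p \<in> U then weyl_form A D g p v else 0"
    note R = rad_conf[OF g]
    \<comment> \<open>These notions see the metric only through its radical, so they may be
      exchanged between \<open>g\<close> and \<open>g0\<close>.\<close>
    have sp: "screen_proj A g \<S> = screen_proj A g0 \<S>"
      unfolding screen_proj_def R ..
    have hf: "hor_forms1 A g = hor_forms1 A g0" unfolding hor_forms1_def R ..
    have sf: "screen_second_form A g \<S> = screen_second_form A g0 \<S>"
      unfolding screen_second_form_def sp ..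
    note cong = sp hf sf
    have "?t \<in> forms1 A U"
    proof -
      have "smooth_fun A V (\<lambda>p. ?t p (X p))" if V: "open V" "V \<subseteq> U" "X \<in> vfields A V" for V X
        by (rule M.smooth_fun_cong[OF V(1) _ M.forms1D(5)[OF wf(1)[OF g] V(1) subset_UNIV V(3)]])
          (use V in auto)
      moreover have "linear_on (tspace A p) (weyl_form A D g p)" for p
        using wf(1)[OF g] by (simp add: forms1_def)
      ultimately show ?thesis
        using M.forms1D(4)[OF wf(1)[OF g]] by (auto simp: forms1_def)
    qed
    then have t: "?t \<in> hor_forms1 A g U" using hor[OF g] by (auto simp: hor_forms1_def R)
    interpret L: weyl_local A U g \<S> \<xi> \<eta> ?t D Dg
    proof unfold_locales
      show "is_connection A U D"
        unfolding is_connection_def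
        by (intro allI impI, elim conjE,
            rule mp[OF spec[OF D(1)[unfolded is_connection_def]] conjI[OF _ subset_UNIV]])
      show "torsion_free A U D" using D(2) unfolding torsion_free_def by blast
      show "weyl_related A U D g ?t"
        unfolding weyl_related_def
      proof (intro allI impI ballI)
        fix V X Y Z p
        assume V: "open V \<and> V \<subseteq> U \<and> X \<in> vfields A V \<and> Y \<in> vfields A V \<and> Z \<in> vfields A V"
          and p: "p \<in> V"
        have "cov_deriv2 D g X Y Z p = - 2 * weyl_form A D g p (X p) * g p (Y p) (Z p)"
          using wf(2)[OF g] V p unfolding weyl_related_def by blast
        then show "cov_deriv2 D g X Y Z p = - 2 * ?t p (X p) * g p (Y p) (Z p)"
          using V p by auto
      qed
      show "\<S> p \<inter> rad A g p = {0}" for p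
        using assms(5) by (simp add: screen_distribution_def R)
    qed (use U bil_g[OF g] xi eta Dg t R in auto)
    show ?thesis
    proof (intro exI conjI allI impI ballI)
      show "?t \<in> hor_forms1 A g0 U" using t by (simp add: cong)
      show "L.S \<in> sym_forms2 A U" by (rule L.S_form)
      show "weyl_formula A U D Dg g \<eta> \<xi> ?t L.S" by (rule L.formula)
      show "?t p = weyl_form A D g p" if "p \<in> U" for p using that by simp
      show "L.S p v w = 0" if "p \<in> U" "v \<in> rad A g0 p" "w \<in> rad A g0 p" for p v w
        using L.S_rad[OF Dxi] that by (simp add: R)
      show "L.S p v w = C p v w + \<eta> p v * ?t p w" if "p \<in> U" "v \<in> tspace A p" "w \<in> \<S> p" for p v w
        using L.S_screen[unfolded cong, OF DS C that] .
    qed (use L.formula_unique[unfolded cong] in blast)+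
  qed
  show ?thesis
    using part1 by (intro conjI ballI allI impI, blast, elim conjE, intro part2)
qed

end
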